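(* Let $\mathcal{P}$ be a non-trivial, hereditary and additive hypergraph property with $d(\mathcal{P})=r$, and let $H$ be a connected hypergraph. Then $$\chi^\ell(H:\mathcal{P})\le\left\lceil\frac{\Delta(H)}{r}\right\rceil+1,$$ and if equality holds, then $H=tK_{(kr+t)/t}$ for some integers $t\ge1$, $k\ge0$; or $H=tC_n$ with $t=r$, $n\ge3$ odd and $\chi^\ell(H:\mathcal{P})=3$; or $H$ is $r$-regular and $H\in\mathcal{F}(\mathcal{P})$.
   Context: A hypergraph is a triple $H=(V,E,i)$ with $V,E$ finite and $i:E\to 2^V$, $|i(e)|\ge 2$ (parallel edges allowed). $H[X]$ is the induced subhypergraph on $X$, $H-v=H[V(H)\setminus\{v\}]$; $d_H(v)$ is the number of edges containing $v$, $\delta,\Delta$ the minimum/maximum degree; $r$-regular means all degrees equal $r$. $H$ is connected if any two vertices are joined by a hyperpath (alternating distinct vertices and edges, consecutive vertices lying in the edge between them). For a simple graph $G$ and $t\ge1$, $tG$ replaces every edge by $t$ parallel edges; $K_n$ is the complete graph and $C_n$ the cycle with edges of size 2. A hypergraph property is an isomorphism-closed class of hypergraphs; hereditary means closed under induced subhypergraphs; non-trivial means it contains a non-empty hypergraph but not all hypergraphs; additive means closed under vertex-disjoint unions. $\mathcal{F}(\mathcal{P})$ is the class of $H\notin\mathcal{P}$ with $H-v\in\mathcal{P}$ for all $v$, and $d(\mathcal{P})=\min\{\delta(H):H\in\mathcal{F}(\mathcal{P})\}$. For $L:V(H)\to 2^C$, a $(\mathcal{P},L)$-coloring is $\varphi:V(H)\to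 C$ with $\varphi(v)\in L(v)$ and $H[\varphi^{-1}(c)]\in\mathcal{P}$ for all $c$; $\chi^\ell(H:\mathcal{P})$ is the least $k$ such that $H$ is $(\mathcal{P},L)$-colorable for every $L$ with $|L(v)|\ge k$ for all $v$. *)

theory Defs
  imports Complex_Main "HOL-Library.Infinite_Typeclass"
begin

(* Ambient hypergraphs live over vertex and edge types of sort infinite, so that every finite
   hypergraph has an isomorphic copy in the ambient type and the copies of two given hypergraphs
   can be chosen disjoint.  The values of inc outside of edges are irrelevant. *)

record ('v, 'e) hgraph =
  verts :: "'v set"
  edges :: "'e set"
  inc :: "'e \<Rightarrow> 'v set"

definition hypergraph :: "('v, 'e) hgraph \<Rightarrow> bool" where
  "hypergraph H \<longleftrightarrow> finite (verts H) \<and> finite (edges H) \<and>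
     (\<forall>e\<in>edges H. inc H e \<subseteq> verts H \<and> card (inc H e) \<ge> 2)"

definition induced :: "('v, 'e) hgraph \<Rightarrow> 'v set \<Rightarrow> ('v, 'e) hgraph" where
  "induced H X = \<lparr>verts = X, edges = {e \<in> edges H. inc H e \<subseteq> X}, inc = inc H\<rparr>"

definition del_vert :: "('v, 'e) hgraph \<Rightarrow> 'v \<Rightarrow> ('v, 'e) hgraph" where
  "del_vert H v = induced H (verts H - {v})"

definition degree :: "('v, 'e) hgraph \<Rightarrow> 'v \<Rightarrow> nat" where
  "degree H v = card {e \<in> edges H. v \<in> inc H e}"

(* On nat, Inf and Sup are minimum and maximum of finite non-empty sets; both are 0 on the empty
   set, so the empty hypergraph has minimum and maximum degree 0. *)

definition min_degree :: "('v, 'e) hgraph \<Rightarrow> nat" where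
  "min_degree H = (INF v\<in>verts H. degree H v)"

definition max_degree :: "('v, 'e) hgraph \<Rightarrow> nat" where
  "max_degree H = (SUP v\<in>verts H. degree H v)"

definition regular :: "nat \<Rightarrow> ('v, 'e) hgraph \<Rightarrow> bool" where
  "regular r H \<longleftrightarrow> (\<forall>v\<in>verts H. degree H v = r)"

definition hyperpath :: "('v, 'e) hgraph \<Rightarrow> 'v list \<Rightarrow> 'e list \<Rightarrow> bool" where
  "hyperpath H vs es \<longleftrightarrow>
     length vs = Suc (length es) \<and> distinct vs \<and> distinct es \<and>
     set vs \<subseteq> verts H \<and> set es \<subseteq> edges H \<and>
     (\<forall>j<length es. vs ! j \<in> inc H (es ! j) \<and> vs ! Suc j \<in> inc H (es ! j))"

definition connected_hg :: "('v, 'e) hgraph \<Rightarrow> bool" where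
  "connected_hg H \<longleftrightarrow>
     (\<forall>u\<in>verts H. \<forall>v\<in>verts H. \<exists>vs es. hyperpath H vs es \<and> hd vs = u \<and> last vs = v)"

definition isomorphic :: "('v, 'e) hgraph \<Rightarrow> ('w, 'f) hgraph \<Rightarrow> bool" where
  "isomorphic G H \<longleftrightarrow>
     (\<exists>f g. bij_betw f (verts G) (verts H) \<and> bij_betw g (edges G) (edges H) \<and>
            (\<forall>e\<in>edges G. inc H (g e) = f ` inc G e))"

definition disj_union :: "('v, 'e) hgraph \<Rightarrow> ('v, 'e) hgraph \<Rightarrow> ('v, 'e) hgraph" where
  "disj_union G H = \<lparr>verts = verts G \<union> verts H, edges = edges G \<union> edges H,
     inc = (\<lambda>e. if e \<in> edges G then inc G e else inc H e)\<rparr>"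

definition hypergraph_property :: "('v, 'e) hgraph set \<Rightarrow> bool" where
  "hypergraph_property P \<longleftrightarrow>
     (\<forall>G\<in>P. hypergraph G) \<and> (\<forall>G\<in>P. \<forall>H. hypergraph H \<and> isomorphic G H \<longrightarrow> H \<in> P)"

definition nontrivial :: "('v, 'e) hgraph set \<Rightarrow> bool" where
  "nontrivial P \<longleftrightarrow> (\<exists>G\<in>P. verts G \<noteq> {}) \<and> (\<exists>H. hypergraph H \<and> H \<notin> P)"

definition hereditary :: "('v, 'e) hgraph set \<Rightarrow> bool" where
  "hereditary P \<longleftrightarrow> (\<forall>G\<in>P. \<forall>X. X \<subseteq> verts G \<longrightarrow> induced G X \<in> P)"

definition additive_prop :: "('v, 'e) hgraph set \<Rightarrow> bool" where
  "additive_prop P \<longleftrightarrow>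
     (\<forall>G\<in>P. \<forall>H\<in>P. verts G \<inter> verts H = {} \<and> edges G \<inter> edges H = {} \<longrightarrow> disj_union G H \<in> P)"

definition crit :: "('v, 'e) hgraph set \<Rightarrow> ('v, 'e) hgraph set" where
  "crit P = {H. hypergraph H \<and> H \<notin> P \<and> (\<forall>v\<in>verts H. del_vert H v \<in> P)}"

definition crit_degree :: "('v, 'e) hgraph set \<Rightarrow> nat" where
  "crit_degree P = (INF H\<in>crit P. min_degree H)"

definition list_coloring ::
    "('v, 'e) hgraph set \<Rightarrow> ('v, 'e) hgraph \<Rightarrow> ('v \<Rightarrow> 'c set) \<Rightarrow> ('v \<Rightarrow> 'c) \<Rightarrow> bool" where
  "list_coloring P H L \<phi> \<longleftrightarrow>
     (\<forall>v\<in>verts H. \<phi> v \<in> L v) \<and> (\<forall>c. induced H {v \<in> verts H. \<phi> v = c} \<in> P)"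

(* Lists may be infinite (card is 0 on infinite sets, hence the guard).  Taking nat as the color
   set loses no generality: finite sublists suffice, and their finite union embeds into nat. *)

definition list_chromatic_number :: "('v, 'e) hgraph \<Rightarrow> ('v, 'e) hgraph set \<Rightarrow> nat" where
  "list_chromatic_number H P =
     (LEAST k. \<forall>L :: 'v \<Rightarrow> nat set.
        (\<forall>v\<in>verts H. finite (L v) \<longrightarrow> k \<le> card (L v)) \<longrightarrow> (\<exists>\<phi>. list_coloring P H L \<phi>))"

definition complete_hg :: "nat \<Rightarrow> (nat, nat set) hgraph" where
  "complete_hg n = \<lparr>verts = {..<n}, edges = {e. e \<subseteq> {..<n} \<and> card e = 2}, inc = id\<rparr>"

definition cycle_hg :: "nat \<Rightarrow> (nat, nat set) hgraph" where
  "cycle_hg n = \<lparr>verts = {..<n}, edges = {{j, Suc j mod n} | j. j < n}, inc = id\<rparr>"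

definition multiple :: "nat \<Rightarrow> ('v, 'e) hgraph \<Rightarrow> ('v, 'e \<times> nat) hgraph" where
  "multiple t G = \<lparr>verts = verts G, edges = edges G \<times> {..<t}, inc = (\<lambda>(e, j). inc G e)\<rparr>"

end

theory Submission
  imports Defs
begin

text \<open>
  Write \<open>k = \<lceil>\<Delta>(H) / r\<rceil>\<close>. A set of vertices all of whose non-empty subsets induce a vertex of degree less than
  \<open>r\<close> induces a member of \<open>P\<close>, since otherwise it would contain a critical hypergraph. Colouring greedily
  with such classes gives the bound. If lists of size \<open>k\<close> do not suffice, then \<open>H\<close> is \<open>rk\<close>-regular, and for
  every colouring of \<open>H - v\<close> each colour in the list of \<open>v\<close> accounts for exactly \<open>r\<close> edges at \<open>v\<close>, all of them
  monochromatic apart from \<open>v\<close>. Hence the uncoloured vertex behaves like a token: it can be slid to any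
  neighbour \<open>u\<close>, with \<open>v\<close> receiving the colour of \<open>u\<close>, and the colour counts seen from a token position never
  change. For \<open>k \<ge> 2\<close>, sliding the token around in an end block shows that edges have size two, that
  neighbours of the token with different colours are adjacent unless the block is an odd cycle, and that all
  multiplicities agree. So the block is regular, and by connectedness it is all of \<open>H\<close>.
\<close>

section \<open>Sliding a token\<close>

text \<open>Since \<open>P\<close> enters only through \<open>r\<close>, the argument works
  throughout with degenerate classes: a failing list colouring is used to infer that these stricter
  colourings fail too. The conserved colour counts are the only information available. They are
  exploited by producing two states that differ only on a set \<open>D\<close> and moving the token
  in both along one walk off \<open>D\<close>, to a position where the counts on \<open>D\<close>
  would have to differ. The obstacle is the vertex through which the block is attached to the rest:
  some of its edges lie outside, so inside the block it need not see two colours. Colours outside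
  are therefore frozen, which makes those edges contribute constants, and two visible colours are
  demanded only at the other vertices. For \<open>k = 1\<close> all neighbours of the token have the
  same colour and sliding tells nothing; this is where the critical hypergraphs arise. For
  \<open>k = 0\<close> only \<open>K_1\<close> is left. A triangle counts as complete, so the cycles
  found here have length at least 5; having only two neighbours per vertex, they force
  \<open>k = 2\<close>.\<close>

text \<open>
  \<open>S v\<close> is the set of colourings with the token on \<open>v\<close>; the value \<open>\<phi> v\<close> of such a colouring is meaningless.
\<close>

locale sliding =
  fixes V :: "'v set" and \<mu> :: "'v \<Rightarrow> 'v \<Rightarrow> nat" and S :: "'v \<Rightarrow> ('v \<Rightarrow> 'c) set"
  assumes finite_V: "finite V"
    and mult_sym: "\<mu> u v = \<mu> v u"
    and mult_irrefl: "\<mu> v v = 0"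
    and slide: "\<lbrakk>v \<in> V; u \<in> V; 0 < \<mu> v u; \<phi> \<in> S v\<rbrakk> \<Longrightarrow> \<phi>(v := \<phi> u) \<in> S u"
    and balanced: "\<lbrakk>v \<in> V; \<phi> \<in> S v; \<phi>' \<in> S v\<rbrakk> \<Longrightarrow>
      (\<Sum>u\<in>V. if \<phi> u = c then \<mu> v u else 0) = (\<Sum>u\<in>V. if \<phi>' u = c then \<mu> v u else 0)"
begin

section \<open>Walks of the token that avoid a set\<close>

definition adj :: "'v \<Rightarrow> 'v \<Rightarrow> bool" where
  "adj u v \<longleftrightarrow> u \<in> V \<and> v \<in> V \<and> 0 < \<mu> u v"

text \<open>The start of the walk is exempt from avoiding \<open>D\<close>. In
  \<open>cycle_spans\<close> walks leave a cycle from one of its own vertices; the price is the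
  extra premise of \<open>reach_notin\<close> and \<open>reach_sym\<close>.\<close>

definition reach :: "'v set \<Rightarrow> 'v \<Rightarrow> 'v \<Rightarrow> bool" where
  "reach D = (\<lambda>a b. adj a b \<and> b \<notin> D)\<^sup>*\<^sup>*"

lemma adj_sym: "adj u v \<longleftrightarrow> adj v u"
  by (auto simp: adj_def mult_sym)

lemma adj_irrefl [simp]: "\<not> adj v v"
  by (simp add: adj_def mult_irrefl)

lemma adj_in: "adj u v \<Longrightarrow> u \<in> V \<and> v \<in> V"
  by (simp add: adj_def)

lemma slide_adj: "\<lbrakk>adj v u; \<phi> \<in> S v\<rbrakk> \<Longrightarrow> \<phi>(v := \<phi> u) \<in> S u"
  using slide by (simp add: adj_def)

lemma reach_refl: "reach D v v"
  by (simp add: reach_def)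

lemma reach_step: "\<lbrakk>reach D v a; adj a b; b \<notin> D\<rbrakk> \<Longrightarrow> reach D v b"
  unfolding reach_def by (rule rtranclp.rtrancl_into_rtrancl) auto

lemma reach_trans: "\<lbrakk>reach D u v; reach D v w\<rbrakk> \<Longrightarrow> reach D u w"
  unfolding reach_def by (rule rtranclp_trans)

lemma reach_mono: "\<lbrakk>reach D v a; D' \<subseteq> D\<rbrakk> \<Longrightarrow> reach D' v a"
  unfolding reach_def by (erule rtranclp_mono[THEN predicate2D, rotated]) auto

lemma reach_notin: "\<lbrakk>reach D v a; v \<notin> D\<rbrakk> \<Longrightarrow> a \<notin> D"
  unfolding reach_def by (induction rule: rtranclp_induct) auto

lemma reach_in: "\<lbrakk>reach D v a; v \<in> V\<rbrakk> \<Longrightarrow> a \<in> V"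
  unfolding reach_def by (induction rule: rtranclp_induct) (auto simp: adj_def)

lemma reach_sym: "\<lbrakk>reach D v a; v \<notin> D\<rbrakk> \<Longrightarrow> reach D a v"
proof -
  assume *: "reach D v a" "v \<notin> D"
  from *(1) have "reach D v a \<and> reach D a v"
    unfolding reach_def[of D]
  proof (induction rule: rtranclp_induct)
    case base
    then show ?case by simp
  next
    case (step y z)
    then have y: "reach D v y" "reach D y v" by (auto simp: reach_def)
    have "y \<notin> D" using reach_notin[OF y(1) *(2)] .
    then have "reach D z y" using step(2) reach_step[OF reach_refl, of z y D] adj_sym by blast
    then have "reach D z v" using y(2) reach_trans by blast
    moreover have "reach D v z" using reach_step[OF y(1)] step(2) by blast
    ultimately show ?case by (simp add: reach_def)
  qed
  then show "reach D a v" by simp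
qed

text \<open>A slide from \<open>y\<close> to \<open>z\<close> changes only the colour of
  \<open>y\<close>, and to that of \<open>z\<close>. As \<open>z\<close> lies off \<open>D\<close>,
  both states assign the same colour to \<open>y\<close>, while the colours on \<open>D\<close> stay
  as they were.\<close>

lemma reach_transport:
  assumes "reach D v y" "v \<in> V" "v \<notin> D" "\<phi> \<in> S v" "\<phi>' \<in> S v"
    and "\<And>x. \<lbrakk>x \<in> V; x \<notin> D; x \<noteq> v\<rbrakk> \<Longrightarrow> \<phi> x = \<phi>' x"
  obtains \<psi> \<psi>' where "\<psi> \<in> S y" "\<psi>' \<in> S y" "\<And>d. d \<in> D \<Longrightarrow> \<psi> d = \<phi> d" "\<And>d. d \<in> D \<Longrightarrow> \<psi>' d = \<phi>' d"
    "\<And>x. \<lbrakk>x \<in> V; x \<notin> D; x \<noteq> y\<rbrakk> \<Longrightarrow> \<psi> x = \<psi>' x"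
proof -
  let ?Q = "\<lambda>y. y \<notin> D \<and> (\<exists>\<psi> \<psi>'. \<psi> \<in> S y \<and> \<psi>' \<in> S y \<and> (\<forall>d\<in>D. \<psi> d = \<phi> d \<and> \<psi>' d = \<phi>' d) \<and>
    (\<forall>x\<in>V. x \<notin> D \<longrightarrow> x \<noteq> y \<longrightarrow> \<psi> x = \<psi>' x))"
  from assms(1) have "?Q y" unfolding reach_def
  proof (induction rule: rtranclp_induct)
    case base
    have "(\<forall>d\<in>D. \<phi> d = \<phi> d \<and> \<phi>' d = \<phi>' d) \<and> (\<forall>x\<in>V. x \<notin> D \<longrightarrow> x \<noteq> v \<longrightarrow> \<phi> x = \<phi>' x)"
      using assms(6) by simp
    then show ?case using assms(3,4,5) by blast
  next
    case (step y z)
    then obtain \<psi> \<psi>' where *: "y \<notin> D" "\<psi> \<in> S y" "\<psi>' \<in> S y" "\<forall>d\<in>D. \<psi> d = \<phi> d \<and> \<psi>' d = \<phi>' d"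
      "\<forall>x\<in>V. x \<notin> D \<longrightarrow> x \<noteq> y \<longrightarrow> \<psi> x = \<psi>' x" by blast
    have yz: "adj y z" "z \<notin> D" using step by auto
    then have "y \<noteq> z" by auto
    have "\<psi>(y := \<psi> z) \<in> S z" "\<psi>'(y := \<psi>' z) \<in> S z"
      using slide_adj[OF yz(1)] *(2,3) by auto
    moreover have "\<forall>d\<in>D. (\<psi>(y := \<psi> z)) d = \<phi> d \<and> (\<psi>'(y := \<psi>' z)) d = \<phi>' d" using *(1,4) by auto
    moreover have "\<psi> z = \<psi>' z" using *(5) yz \<open>y \<noteq> z\<close> adj_in by auto
    then have "\<forall>x\<in>V. x \<notin> D \<longrightarrow> x \<noteq> z \<longrightarrow> (\<psi>(y := \<psi> z)) x = (\<psi>'(y := \<psi>' z)) x"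
      using *(5) by auto
    ultimately show ?case using yz(2) by blast
  qed
  then show ?thesis using that by blast
qed

text \<open>The terms off \<open>D\<close> cancel: there the states agree, except perhaps for the
  meaningless colour at \<open>v\<close>, which has weight \<open>\<mu> v v = 0\<close>.\<close>

lemma balanced_on:
  assumes "v \<in> V" "v \<notin> D" "\<phi> \<in> S v" "\<phi>' \<in> S v" "D \<subseteq> V"
    and "\<And>x. \<lbrakk>x \<in> V; x \<notin> D; x \<noteq> v\<rbrakk> \<Longrightarrow> \<phi> x = \<phi>' x"
  shows "(\<Sum>u\<in>D. if \<phi> u = c then \<mu> v u else 0) = (\<Sum>u\<in>D. if \<phi>' u = c then \<mu> v u else 0)"
proof -
  have split: "(\<Sum>u\<in>V. g u) = (\<Sum>u\<in>V - D. g u) + (\<Sum>u\<in>D. g u)" for g :: "'v \<Rightarrow> nat"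
    using sum.subset_diff[OF assms(5) finite_V] .
  have "(\<Sum>u\<in>V - D. if \<phi> u = c then \<mu> v u else 0) = (\<Sum>u\<in>V - D. if \<phi>' u = c then \<mu> v u else 0)"
  proof (rule sum.cong[OF refl])
    fix u assume "u \<in> V - D"
    then show "(if \<phi> u = c then \<mu> v u else 0) = (if \<phi>' u = c then \<mu> v u else 0)"
      using assms(6)[of u] mult_irrefl[of v] by (cases "u = v") auto
  qed
  then show ?thesis using balanced[OF assms(1,3,4), of c] unfolding split by simp
qed

text \<open>The source of the contradictions below: recolouring \<open>D\<close> is invisible, in
  every colour, from each position that the token reaches without entering \<open>D\<close>.\<close>

lemma two_states:
  assumes "reach D v y" "v \<in> V" "v \<notin> D" "\<phi> \<in> S v" "\<phi>' \<in> S v" "D \<subseteq> V"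
    and "\<And>x. \<lbrakk>x \<in> V; x \<notin> D; x \<noteq> v\<rbrakk> \<Longrightarrow> \<phi> x = \<phi>' x"
  shows "(\<Sum>u\<in>D. if \<phi> u = c then \<mu> y u else 0) = (\<Sum>u\<in>D. if \<phi>' u = c then \<mu> y u else 0)"
proof -
  obtain \<psi> \<psi>' where *: "\<psi> \<in> S y" "\<psi>' \<in> S y" "\<And>d. d \<in> D \<Longrightarrow> \<psi> d = \<phi> d" "\<And>d. d \<in> D \<Longrightarrow> \<psi>' d = \<phi>' d"
    "\<And>x. \<lbrakk>x \<in> V; x \<notin> D; x \<noteq> y\<rbrakk> \<Longrightarrow> \<psi> x = \<psi>' x"
    using reach_transport[OF assms(1-5,7)] by blast
  have "(\<Sum>u\<in>D. if \<psi> u = c then \<mu> y u else 0) = (\<Sum>u\<in>D. if \<psi>' u = c then \<mu> y u else 0)"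
    using balanced_on[OF reach_in[OF assms(1,2)] reach_notin[OF assms(1,3)] *(1,2) assms(6) *(5)] .
  then show ?thesis using *(3,4) by simp
qed

section \<open>Ears at the token and the rotation of their colours\<close>

definition ear :: "'v \<Rightarrow> (nat \<Rightarrow> 'v) \<Rightarrow> nat \<Rightarrow> bool" where
  "ear v q l \<longleftrightarrow> 0 < l \<and> inj_on q {..l} \<and> (\<forall>i<l. adj (q i) (q (Suc i))) \<and>
     v \<notin> q ` {..l} \<and> (\<forall>i\<le>l. adj v (q i) \<longleftrightarrow> i = 0 \<or> i = l)"

lemma slide_along:
  assumes "v \<in> V" "inj_on q {..l}" "v \<notin> q ` {..l}" "adj v (q 0)"
    and "\<And>i. i < l \<Longrightarrow> adj (q i) (q (Suc i))" "\<phi> \<in> S v" "m \<le> l"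
  shows "\<exists>\<psi>\<in>S (q m). \<psi> v = \<phi> (q 0) \<and> (\<forall>i<m. \<psi> (q i) = \<phi> (q (Suc i))) \<and>
     (\<forall>x. x \<noteq> v \<longrightarrow> x \<notin> q ` {..<m} \<longrightarrow> \<psi> x = \<phi> x)"
  using \<open>m \<le> l\<close>
proof (induction m)
  case 0
  have "\<phi>(v := \<phi> (q 0)) \<in> S (q 0)" using slide_adj assms by blast
  then show ?case by (intro bexI[of _ "\<phi>(v := \<phi> (q 0))"]) auto
next
  case (Suc m)
  then obtain \<psi> where *: "\<psi> \<in> S (q m)" "\<psi> v = \<phi> (q 0)" "\<forall>i<m. \<psi> (q i) = \<phi> (q (Suc i))"
    "\<forall>x. x \<noteq> v \<longrightarrow> x \<notin> q ` {..<m} \<longrightarrow> \<psi> x = \<phi> x" by auto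
  have inj: "q i = q j \<longleftrightarrow> i = j" if "i \<le> l" "j \<le> l" for i j
    using assms(2) that by (auto simp: inj_on_def)
  have v: "v \<noteq> q i" if "i \<le> l" for i using assms(3) that by auto
  have S: "\<psi>(q m := \<psi> (q (Suc m))) \<in> S (q (Suc m))"
    using slide_adj[OF assms(5)] *(1) Suc.prems by auto
  have sm: "\<psi> (q (Suc m)) = \<phi> (q (Suc m))"
  proof -
    have "q (Suc m) \<notin> q ` {..<m}" using inj Suc.prems by auto
    then show ?thesis using *(4) v[of "Suc m"] Suc.prems by metis
  qed
  have "\<forall>i<Suc m. (\<psi>(q m := \<psi> (q (Suc m)))) (q i) = \<phi> (q (Suc i))"
    using *(3) sm inj Suc.prems by (auto simp: less_Suc_eq)
  moreover have "(\<psi>(q m := \<psi> (q (Suc m)))) v = \<phi> (q 0)" using *(2) v[of m] Suc.prems by auto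
  moreover have "\<forall>x. x \<noteq> v \<longrightarrow> x \<notin> q ` {..<Suc m} \<longrightarrow> (\<psi>(q m := \<psi> (q (Suc m)))) x = \<phi> x"
    using *(4) by (auto simp: lessThan_Suc)
  ultimately show ?case using S by blast
qed

text \<open>Together with \<open>v\<close> an ear is a cycle on \<open>l + 2\<close> vertices; it
  may have chords among the \<open>q i\<close>, but none at \<open>v\<close>. After
  \<open>l + 2\<close> slides the token is back at \<open>v\<close> and each colour has moved one
  place. During the trip \<open>v\<close> stores the colour of \<open>q 0\<close>, which the last
  slide hands to \<open>q l\<close>.\<close>

lemma rotate:
  assumes "ear v q l" "\<phi> \<in> S v"
  obtains \<phi>' where "\<phi>' \<in> S v" "\<And>i. i < l \<Longrightarrow> \<phi>' (q i) = \<phi> (q (Suc i))" "\<phi>' (q l) = \<phi> (q 0)"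
    "\<And>x. \<lbrakk>x \<noteq> v; x \<notin> q ` {..l}\<rbrakk> \<Longrightarrow> \<phi>' x = \<phi> x"
proof -
  have e: "inj_on q {..l}" "v \<notin> q ` {..l}" "adj v (q 0)" "adj (q l) v" "\<And>i. i < l \<Longrightarrow> adj (q i) (q (Suc i))"
    using assms(1) adj_sym unfolding ear_def by auto
  then have "v \<in> V" using adj_in by auto
  obtain \<psi> where *: "\<psi> \<in> S (q l)" "\<psi> v = \<phi> (q 0)" "\<forall>i<l. \<psi> (q i) = \<phi> (q (Suc i))"
    "\<forall>x. x \<noteq> v \<longrightarrow> x \<notin> q ` {..<l} \<longrightarrow> \<psi> x = \<phi> x"
    using slide_along[OF \<open>v \<in> V\<close> e(1,2,3,5) assms(2) order_refl] by blast
  have "q i \<noteq> q l" if "i < l" for i using e(1) that by (auto simp: inj_on_def)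
  then have a: "(\<psi>(q l := \<psi> v)) (q i) = \<phi> (q (Suc i))" if "i < l" for i
    using *(3) that by simp
  have b: "(\<psi>(q l := \<psi> v)) x = \<phi> x" if "x \<noteq> v" "x \<notin> q ` {..l}" for x
  proof -
    have "x \<noteq> q l" "x \<notin> q ` {..<l}" using that(2) by auto
    then show ?thesis using *(4) that(1) by simp
  qed
  show ?thesis using that[OF slide_adj[OF e(4) *(1)] a _ b] *(2) by simp
qed

lemma ear_in:
  assumes "ear v q l"
  shows "v \<in> V" "q ` {..l} \<subseteq> V" "v \<notin> q ` {..l}"
proof -
  show "v \<in> V" "v \<notin> q ` {..l}" using assms adj_in unfolding ear_def by auto
  have "q i \<in> V" if "i \<le> l" for i
  proof (cases "i = l")
    case True
    then show ?thesis using assms adj_in unfolding ear_def by auto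
  next
    case False
    then show ?thesis using assms adj_in that unfolding ear_def by (meson le_neq_implies_less)
  qed
  then show "q ` {..l} \<subseteq> V" by auto
qed

text \<open>Balance before and after one rotation. Of the ear, \<open>v\<close> sees only
  \<open>q 0\<close> and \<open>q l\<close>, so all inner terms vanish.\<close>

lemma ear_balance:
  assumes "ear v q l" "\<phi> \<in> S v"
  shows "(if \<phi> (q 0) = c then \<mu> v (q 0) else 0) + (if \<phi> (q l) = c then \<mu> v (q l) else 0) =
     (if \<phi> (q 1) = c then \<mu> v (q 0) else 0) + (if \<phi> (q 0) = c then \<mu> v (q l) else 0)"
proof -
  obtain \<phi>' where \<phi>': "\<phi>' \<in> S v" "\<And>i. i < l \<Longrightarrow> \<phi>' (q i) = \<phi> (q (Suc i))" "\<phi>' (q l) = \<phi> (q 0)"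
    "\<And>x. \<lbrakk>x \<noteq> v; x \<notin> q ` {..l}\<rbrakk> \<Longrightarrow> \<phi>' x = \<phi> x"
    using rotate[OF assms] by blast
  have l: "0 < l" and inj: "inj_on q {..l}" and nb: "\<And>i. i \<le> l \<Longrightarrow> adj v (q i) \<longleftrightarrow> i = 0 \<or> i = l"
    using assms(1) unfolding ear_def by auto
  have z: "\<mu> v (q i) = 0" if "i \<le> l" "i \<noteq> 0" "i \<noteq> l" for i
    using nb[of i] that ear_in(1,2)[OF assms(1)] unfolding adj_def by auto
  have sum: "(\<Sum>u\<in>q ` {..l}. if \<psi> u = c then \<mu> v u else 0) =
    (if \<psi> (q 0) = c then \<mu> v (q 0) else 0) + (if \<psi> (q l) = c then \<mu> v (q l) else 0)" for \<psi> :: "'v \<Rightarrow> 'c"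
  proof -
    have "(\<Sum>u\<in>q ` {..l}. if \<psi> u = c then \<mu> v u else 0) = (\<Sum>i\<le>l. if \<psi> (q i) = c then \<mu> v (q i) else 0)"
      by (simp add: sum.reindex[OF inj] o_def)
    also have "\<dots> = (\<Sum>i\<in>{0,l}. if \<psi> (q i) = c then \<mu> v (q i) else 0)"
      by (rule sum.mono_neutral_right) (use z in auto)
    finally show ?thesis using l by simp
  qed
  have "(\<Sum>u\<in>q ` {..l}. if \<phi> u = c then \<mu> v u else 0) = (\<Sum>u\<in>q ` {..l}. if \<phi>' u = c then \<mu> v u else 0)"
    by (rule two_states[OF reach_refl]) (use ear_in[OF assms(1)] assms(2) \<phi>' in auto)
  then show ?thesis unfolding sum using \<phi>'(2)[OF l] \<phi>'(3) by simp
qed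

text \<open>In \<open>ear_balance\<close> with the colour of \<open>q l\<close>, the left side is
  \<open>\<mu> v (q l) > 0\<close>, while on the right only the term of \<open>q 1\<close> can
  contribute, with weight \<open>\<mu> v (q 0)\<close>.\<close>

lemma ear_ends:
  assumes "ear v q l" "\<phi> \<in> S v" "\<phi> (q 0) \<noteq> \<phi> (q l)"
  shows "\<mu> v (q 0) = \<mu> v (q l)" "\<phi> (q 1) = \<phi> (q l)"
proof -
  have pos: "0 < \<mu> v (q 0)" "0 < \<mu> v (q l)" using assms(1) unfolding ear_def adj_def by auto
  show "\<phi> (q 1) = \<phi> (q l)" using ear_balance[OF assms(1,2), of "\<phi> (q l)"] assms(3) pos
    by (auto split: if_splits)
  then show "\<mu> v (q 0) = \<mu> v (q l)" using ear_balance[OF assms(1,2), of "\<phi> (q l)"] assms(3) by auto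
qed

text \<open>By \<open>ear_ends\<close> a rotation exchanges the colours of the two ends. Hence the
  claim for \<open>i + 1\<close> is the claim for \<open>i\<close> in the rotated state, which is
  why the state is generalised in the induction.\<close>

lemma ear_alternating:
  assumes "ear v q l" "\<phi> \<in> S v" "\<phi> (q 0) \<noteq> \<phi> (q l)" "i \<le> l"
  shows "\<phi> (q i) = (if even i then \<phi> (q 0) else \<phi> (q l))"
  using assms(2-4)
proof (induction i arbitrary: \<phi>)
  case 0
  then show ?case by simp
next
  case (Suc i)
  obtain \<phi>' where \<phi>': "\<phi>' \<in> S v" "\<And>i. i < l \<Longrightarrow> \<phi>' (q i) = \<phi> (q (Suc i))" "\<phi>' (q l) = \<phi> (q 0)"
    by (rule rotate[OF assms(1) Suc.prems(1)]) blast
  have "0 < l" using assms(1) unfolding ear_def by auto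
  then have "\<phi>' (q 0) = \<phi> (q l)"
    using ear_ends(2)[OF assms(1) Suc.prems(1,2)] \<phi>'(2)[of 0] by simp
  then have "\<phi>' (q i) = (if even i then \<phi> (q l) else \<phi> (q 0))"
    using Suc.IH[OF \<phi>'(1)] \<phi>'(3) Suc.prems(2,3) by simp
  then show ?case using \<phi>'(2)[of i] Suc.prems(3) by simp
qed

lemma ear_odd:
  assumes "ear v q l" "\<phi> \<in> S v" "\<phi> (q 0) \<noteq> \<phi> (q l)"
  shows "odd l"
  using ear_alternating[OF assms order_refl] assms(3) by (auto split: if_splits)

text \<open>Colours alternate along the ear and its ends differ, so each vertex differs from the one
  whose colour it receives.\<close>

lemma rotate_changes:
  assumes "ear v q l" "\<phi> \<in> S v" "\<phi> (q 0) \<noteq> \<phi> (q l)"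
  obtains \<phi>' where "\<phi>' \<in> S v" "\<And>i. i \<le> l \<Longrightarrow> \<phi>' (q i) \<noteq> \<phi> (q i)"
    "\<And>x. \<lbrakk>x \<in> V; x \<notin> q ` {..l}; x \<noteq> v\<rbrakk> \<Longrightarrow> \<phi> x = \<phi>' x"
proof -
  obtain \<phi>' where \<phi>': "\<phi>' \<in> S v" "\<And>i. i < l \<Longrightarrow> \<phi>' (q i) = \<phi> (q (Suc i))" "\<phi>' (q l) = \<phi> (q 0)"
    "\<And>x. \<lbrakk>x \<noteq> v; x \<notin> q ` {..l}\<rbrakk> \<Longrightarrow> \<phi>' x = \<phi> x"
    using rotate[OF assms(1,2)] by blast
  have "\<phi>' (q i) \<noteq> \<phi> (q i)" if "i \<le> l" for i
  proof (cases "i = l")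
    case True
    then show ?thesis using \<phi>'(3) assms(3) by simp
  next
    case False
    then show ?thesis
      using \<phi>'(2)[of i] ear_alternating[OF assms, of i] ear_alternating[OF assms, of "Suc i"] that assms(3)
      by (auto split: if_splits)
  qed
  then show ?thesis using that \<phi>'(1,4) by metis
qed

text \<open>
  Running the token once around the ear recolours every vertex of the ear, so a token position reached without
  touching the ear would see a different number of edges of some colour.
\<close>

lemma no_unique_contact:
  assumes "ear v q l" "\<phi> \<in> S v" "\<phi> (q 0) \<noteq> \<phi> (q l)" "reach (q ` {..l}) v x"
    and "i \<le> l" "adj x (q i)" "\<And>j. \<lbrakk>j \<le> l; adj x (q j)\<rbrakk> \<Longrightarrow> j = i"
  shows False
proof -
  obtain \<phi>' where \<phi>': "\<phi>' \<in> S v" "\<And>i. i \<le> l \<Longrightarrow> \<phi>' (q i) \<noteq> \<phi> (q i)"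
    "\<And>x. \<lbrakk>x \<in> V; x \<notin> q ` {..l}; x \<noteq> v\<rbrakk> \<Longrightarrow> \<phi> x = \<phi>' x"
    using rotate_changes[OF assms(1-3)] by blast
  let ?c = "\<phi> (q i)"
  have eq: "(\<Sum>u\<in>q ` {..l}. if \<phi> u = ?c then \<mu> x u else 0) = (\<Sum>u\<in>q ` {..l}. if \<phi>' u = ?c then \<mu> x u else 0)"
    by (rule two_states[OF assms(4) ear_in(1)[OF assms(1)] ear_in(3)[OF assms(1)] assms(2) \<phi>'(1)
          ear_in(2)[OF assms(1)] \<phi>'(3)])
  have z: "\<mu> x (q j) = 0" if "j \<le> l" "j \<noteq> i" for j
  proof -
    have "\<not> adj x (q j)" using assms(7) that by blast
    then show ?thesis using that(1) ear_in(2)[OF assms(1)] adj_in[OF assms(6)] by (auto simp: adj_def)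
  qed
  have "(\<Sum>u\<in>q ` {..l}. if \<phi>' u = ?c then \<mu> x u else 0) = 0"
  proof (intro sum.neutral ballI)
    fix u assume "u \<in> q ` {..l}"
    then obtain j where "j \<le> l" "u = q j" by auto
    then show "(if \<phi>' u = ?c then \<mu> x u else 0) = 0" using \<phi>'(2)[of j] z[of j] by (cases "j = i") auto
  qed
  moreover have "\<mu> x (q i) \<le> (\<Sum>u\<in>q ` {..l}. if \<phi> u = ?c then \<mu> x u else 0)"
    using member_le_sum[of "q i" "q ` {..l}" "\<lambda>u. if \<phi> u = ?c then \<mu> x u else 0"] assms(5) by simp
  ultimately have "\<mu> x (q i) \<le> 0" using eq by linarith
  then show False using assms(6) unfolding adj_def by simp
qed

end

text \<open>Applied with \<open>N\<close> as "is a neighbour of the token" along a path: two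
  neighbours of different colours enclose two consecutive ones of different colours, and the piece
  between these is an ear.\<close>

lemma consecutive_differing:
  fixes \<phi> :: "nat \<Rightarrow> 'c"
  assumes "i < j" "N i" "N j" "\<phi> i \<noteq> \<phi> j"
  obtains a b where "i \<le> a" "a < b" "b \<le> j" "N a" "N b" "\<phi> a \<noteq> \<phi> b" "\<And>m. \<lbrakk>a < m; m < b\<rbrakk> \<Longrightarrow> \<not> N m"
  using assms
proof (induction "j - i" arbitrary: i j thesis rule: less_induct)
  case less
  show ?case
  proof (cases "\<exists>m. i < m \<and> m < j \<and> N m")
    case False
    then show ?thesis using less.prems(1)[of i j] less.prems by blast
  next
    case True
    then obtain m where m: "i < m" "m < j" "N m" by blast
    consider "\<phi> i \<noteq> \<phi> m" | "\<phi> m \<noteq> \<phi> j" using less.prems(5) by metis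
    then show ?thesis
    proof cases
      case 1
      obtain a b where "i \<le> a" "a < b" "b \<le> m" "N a" "N b" "\<phi> a \<noteq> \<phi> b" "\<And>x. \<lbrakk>a < x; x < b\<rbrakk> \<Longrightarrow> \<not> N x"
        by (rule less.hyps[of m i]) (use m 1 less.prems(3) in auto)
      then show ?thesis using less.prems(1)[of a b] m(2) by simp
    next
      case 2
      obtain a b where "m \<le> a" "a < b" "b \<le> j" "N a" "N b" "\<phi> a \<noteq> \<phi> b" "\<And>x. \<lbrakk>a < x; x < b\<rbrakk> \<Longrightarrow> \<not> N x"
        by (rule less.hyps[of j m]) (use m 2 less.prems(4) in auto)
      then show ?thesis using less.prems(1)[of a b] m(1) by simp
    qed
  qed
qed

section \<open>Induced cycles through the token\<close>

context sliding
begin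

text \<open>Connectedness of the graph induced on \<open>U\<close>, phrased by cuts. Required of
  \<open>V - {v}\<close> for every \<open>v\<close>, it expresses that the block has no cut
  vertex.\<close>

definition crossing :: "'v set \<Rightarrow> bool" where
  "crossing U \<longleftrightarrow> (\<forall>X\<subseteq>U. X \<noteq> {} \<longrightarrow> X \<noteq> U \<longrightarrow> (\<exists>y\<in>X. \<exists>z\<in>U - X. adj y z))"

lemma crossingD:
  assumes "crossing U" "X \<subseteq> U" "X \<noteq> {}" "X \<noteq> U"
  obtains y z where "y \<in> X" "z \<in> U" "z \<notin> X" "adj y z"
  using assms unfolding crossing_def by blast

lemma reach_up:
  assumes "reach D v (q a)" "a \<le> b" "\<And>i. \<lbrakk>a \<le> i; i < b\<rbrakk> \<Longrightarrow> adj (q i) (q (Suc i))"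
    "\<And>i. \<lbrakk>a < i; i \<le> b\<rbrakk> \<Longrightarrow> q i \<notin> D"
  shows "reach D v (q b)"
  using assms(2-)
proof (induction b rule: dec_induct)
  case base
  then show ?case using assms(1) by simp
next
  case (step n)
  have "reach D v (q n)" using step by simp
  then show ?case using reach_step[of D v "q n" "q (Suc n)"] step.prems step.hyps by simp
qed

lemma reach_down:
  assumes "reach D v (q b)" "a \<le> b" "\<And>i. \<lbrakk>a \<le> i; i < b\<rbrakk> \<Longrightarrow> adj (q i) (q (Suc i))"
    "\<And>i. \<lbrakk>a \<le> i; i < b\<rbrakk> \<Longrightarrow> q i \<notin> D"
  shows "reach D v (q a)"
  using assms(2-)
proof (induction a rule: inc_induct)
  case base
  then show ?case using assms(1) by simp
next
  case (step n)
  have "reach D v (q (Suc n))" using step by simp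
  then show ?case
    using reach_step[of D v "q (Suc n)" "q n"] step.prems(1)[of n] step.prems(2)[of n] step.hyps adj_sym by simp
qed

text \<open>A shortest path inside \<open>U\<close>: a repeated vertex or a chord would give a
  shorter one.\<close>

lemma induced_path:
  assumes "crossing U" "u \<in> U" "w \<in> U" "u \<noteq> w"
  obtains q l where "q 0 = u" "q l = w" "0 < l" "inj_on q {..l}" "\<And>i. i \<le> l \<Longrightarrow> q i \<in> U"
    "\<And>i j. \<lbrakk>i \<le> l; j \<le> l\<rbrakk> \<Longrightarrow> adj (q i) (q j) \<longleftrightarrow> i = Suc j \<or> j = Suc i"
proof -
  define R where "R = {(a, b). a \<in> U \<and> b \<in> U \<and> adj a b}"
  have "(u, w) \<in> R\<^sup>*"
  proof (rule ccontr)
    assume n: "(u, w) \<notin> R\<^sup>*"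
    let ?X = "{x \<in> U. (u, x) \<in> R\<^sup>*}"
    have "u \<in> ?X" "w \<notin> ?X" using assms(2) n by auto
    then obtain y z where "y \<in> ?X" "z \<in> U" "z \<notin> ?X" "adj y z"
      using crossingD[OF assms(1), of ?X] assms(3) by blast
    then have "(u, y) \<in> R\<^sup>*" "(y, z) \<in> R" by (simp_all add: R_def)
    then have "(u, z) \<in> R\<^sup>*" by (rule rtrancl_into_rtrancl)
    then show False using \<open>z \<in> U\<close> \<open>z \<notin> ?X\<close> by simp
  qed
  then have ex: "\<exists>n. (u, w) \<in> R ^^ n" by (simp add: rtrancl_power)
  define l where "l = (LEAST n. (u, w) \<in> R ^^ n)"
  have "(u, w) \<in> R ^^ l" unfolding l_def using LeastI_ex[OF ex] .
  then obtain q where q: "q 0 = u" "q l = w" "\<And>i. i < l \<Longrightarrow> (q i, q (Suc i)) \<in> R"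
    unfolding relpow_fun_conv by blast
  have least: "l \<le> n" if "(u, w) \<in> R ^^ n" for n unfolding l_def using that by (rule Least_le)
  have seg: "(q i, q j) \<in> R ^^ (j - i)" if "i \<le> j" "j \<le> l" for i j
    unfolding relpow_fun_conv using that q(3) by (intro exI[of _ "\<lambda>m. q (i + m)"]) auto
  have U: "q i \<in> U" if "i \<le> l" for i
  proof (cases "i = l")
    case False
    then show ?thesis using q(3)[of i] that by (simp add: R_def)
  qed (use q(2) assms(3) in simp)
  have ne: "q i \<noteq> q j" if "i < j" "j \<le> l" for i j
  proof
    assume eq: "q i = q j"
    have "(u, q i) \<in> R ^^ i" "(q i, w) \<in> R ^^ (l - j)"
      using seg[of 0 i] seg[of j l] that q(1,2) eq by auto
    then have "(u, w) \<in> R ^^ (i + (l - j))" unfolding relpow_add by blast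
    then show False using least[of "i + (l - j)"] that by linarith
  qed
  have na: "\<not> adj (q i) (q j)" if "Suc i < j" "j \<le> l" for i j
  proof
    assume a: "adj (q i) (q j)"
    have "(u, q i) \<in> R ^^ i" "(q j, w) \<in> R ^^ (l - j)"
      using seg[of 0 i] seg[of j l] that q(1,2) by auto
    moreover have "(q i, q j) \<in> R ^^ 1" using a U that by (simp add: R_def)
    ultimately have "(u, w) \<in> R ^^ (i + 1 + (l - j))" unfolding relpow_add by blast
    then show False using least[of "i + 1 + (l - j)"] that by linarith
  qed
  have "inj_on q {..l}"
    by (rule linorder_inj_onI) (use ne in auto)
  moreover have "adj (q i) (q j) \<longleftrightarrow> i = Suc j \<or> j = Suc i" if "i \<le> l" "j \<le> l" for i j
  proof -
    consider "i = j" | "j = Suc i" | "i = Suc j" | "Suc i < j" | "Suc j < i" by linarith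
    then show ?thesis
    proof cases
      case 2
      then show ?thesis using q(3)[of i] that by (simp add: R_def)
    next
      case 3
      then show ?thesis using q(3)[of j] that adj_sym by (simp add: R_def)
    next
      case 4
      then show ?thesis using na[of i j] that by simp
    next
      case 5
      then show ?thesis using na[of j i] that adj_sym by simp
    qed simp
  qed
  moreover have "0 < l" using q(1,2) assms(4) by (metis gr0I)
  ultimately show ?thesis using that q(1,2) U by blast
qed

text \<open>A shortest path from \<open>u\<close> to \<open>w\<close> off \<open>v\<close> contains
  a segment \<open>q a, ..., q b\<close> that is an ear with differing ends. If it stopped before
  \<open>w\<close>, the token could go from \<open>v\<close> to \<open>w\<close> and back along the
  path to \<open>q (b + 1)\<close>, which touches the ear only in \<open>q b\<close>, against
  \<open>no_unique_contact\<close>. The same argument from \<open>u\<close> gives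
  \<open>a = 0\<close>, so the whole path is the ear.\<close>

lemma token_ear:
  assumes "crossing (V - {v})" "\<phi> \<in> S v" "adj v u" "adj v w" "\<phi> u \<noteq> \<phi> w"
  obtains q l where "ear v q l" "q 0 = u" "q l = w"
    "\<And>i j. \<lbrakk>i \<le> l; j \<le> l\<rbrakk> \<Longrightarrow> adj (q i) (q j) \<longleftrightarrow> i = Suc j \<or> j = Suc i"
proof -
  have "u \<in> V - {v}" "w \<in> V - {v}" "u \<noteq> w" using assms(3-5) adj_in by auto
  then obtain q l where q: "q 0 = u" "q l = w" "0 < l" "inj_on q {..l}" "\<And>i. i \<le> l \<Longrightarrow> q i \<in> V - {v}"
    "\<And>i j. \<lbrakk>i \<le> l; j \<le> l\<rbrakk> \<Longrightarrow> adj (q i) (q j) \<longleftrightarrow> i = Suc j \<or> j = Suc i"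
    using induced_path[OF assms(1)] by blast
  obtain a b where ab: "a < b" "b \<le> l" "adj v (q a)" "adj v (q b)" "\<phi> (q a) \<noteq> \<phi> (q b)"
    "\<And>m. \<lbrakk>a < m; m < b\<rbrakk> \<Longrightarrow> \<not> adj v (q m)"
    using consecutive_differing[of 0 l "\<lambda>i. adj v (q i)" "\<lambda>i. \<phi> (q i)"] q(1-3) assms(3-5) by metis
  let ?q = "\<lambda>i. q (a + i)"
  have inj: "q i = q j \<longleftrightarrow> i = j" if "i \<le> l" "j \<le> l" for i j
    using q(4) that by (auto simp: inj_on_def)
  have nb: "adj v (?q i) \<longleftrightarrow> i = 0 \<or> i = b - a" if "i \<le> b - a" for i
    using ab that by (cases "i = 0 \<or> i = b - a") auto
  have ear: "ear v ?q (b - a)" unfolding ear_def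
  proof (intro conjI allI impI)
    show "inj_on ?q {..b - a}" using inj ab by (auto simp: inj_on_def)
    have "v \<noteq> ?q i" if "i \<le> b - a" for i
    proof -
      have "a + i \<le> l" using that ab(1,2) by linarith
      then show ?thesis using q(5)[of "a + i"] by auto
    qed
    then show "v \<notin> ?q ` {..b - a}" by blast
  qed (use nb ab q(6) in auto)
  have img: "?q ` {..b - a} = q ` {a..b}"
  proof -
    have "{a..b} = (\<lambda>i. a + i) ` {..b - a}" using ab(1)
      by (simp add: atMost_atLeast0)
    then show ?thesis by (simp add: image_image)
  qed
  have ends: "\<phi> (?q 0) \<noteq> \<phi> (?q (b - a))" using ab by simp
  note contact = no_unique_contact[OF ear assms(2) ends, unfolded img]
  have notin: "q i \<notin> q ` {a..b}" if "i \<le> l" "i < a \<or> b < i" for i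
    using inj that ab(2) by auto
  have "b = l"
  proof (rule ccontr)
    assume "b \<noteq> l"
    then have bl: "b < l" using ab by simp
    have "reach (q ` {a..b}) v (q l)"
      using reach_step[OF reach_refl, of v "q l"] assms(4) q(2) notin[of l] bl by simp
    then have "reach (q ` {a..b}) v (q (Suc b))"
      by (rule reach_down) (use bl q(6) notin in auto)
    then show False
      by (rule contact[of _ "b - a"]) (use ab bl q(6) in auto)
  qed
  moreover have "a = 0"
  proof (rule ccontr)
    assume "a \<noteq> 0"
    then have a0: "0 < a" by simp
    have "reach (q ` {a..b}) v (q 0)"
      using reach_step[OF reach_refl, of v "q 0"] assms(3) q(1) notin[of 0] a0 by simp
    then have "reach (q ` {a..b}) v (q (a - 1))"
    proof (rule reach_up)
      show "q i \<notin> q ` {a..b}" if "i \<le> a - 1" for i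
        by (rule notin) (use that a0 ab in linarith)+
    qed (use a0 ab q(6) in auto)
    then show False
      by (rule contact[of _ 0]) (use ab a0 q(6) in auto)
  qed
  ultimately show ?thesis using that[of q l] ear q by simp
qed

text \<open>An induced cycle is given by an enumeration that is periodic with period \<open>n\<close>.\<close>

definition induced_cycle :: "(nat \<Rightarrow> 'v) \<Rightarrow> nat \<Rightarrow> bool" where
  "induced_cycle c n \<longleftrightarrow> (\<forall>i. c i \<in> V) \<and> (\<forall>i j. c i = c j \<longleftrightarrow> i mod n = j mod n) \<and>
     (\<forall>i j. adj (c i) (c j) \<longleftrightarrow> Suc i mod n = j mod n \<or> Suc j mod n = i mod n)"

lemma induced_cycle_shift:
  assumes "induced_cycle c n"
  shows "induced_cycle (\<lambda>i. c (k + i)) n"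
proof -
  have "(k + i) mod n = (k + j) mod n \<longleftrightarrow> i mod n = j mod n" for i j
    by (auto simp: nat_mod_eq_iff algebra_simps)
  from this[of "Suc _"] this[of _ "Suc _"] this show ?thesis
    using assms unfolding induced_cycle_def by simp
qed

lemma induced_cycle_ear:
  assumes "induced_cycle c n" "3 \<le> n"
  shows "ear (c 0) (\<lambda>i. c (Suc i)) (n - 2)"
  unfolding ear_def
proof (intro conjI allI impI)
  show "0 < n - 2" using assms(2) by simp
  have eq: "c i = c j \<longleftrightarrow> i = j" if "i < n" "j < n" for i j
    using assms(1) that unfolding induced_cycle_def by simp
  show "inj_on (\<lambda>i. c (Suc i)) {..n - 2}" using eq assms(2) by (auto simp: inj_on_def)
  show "c 0 \<notin> (\<lambda>i. c (Suc i)) ` {..n - 2}"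
  proof
    assume "c 0 \<in> (\<lambda>i. c (Suc i)) ` {..n - 2}"
    then obtain i where "i \<le> n - 2" "c 0 = c (Suc i)" by blast
    then show False using eq[of 0 "Suc i"] assms(2) by simp
  qed
  fix i
  show "adj (c (Suc i)) (c (Suc (Suc i)))" using assms(1) unfolding induced_cycle_def by simp
  assume "i \<le> n - 2"
  then have "adj (c 0) (c (Suc i)) \<longleftrightarrow> Suc 0 mod n = Suc i mod n \<or> Suc (Suc i) mod n = 0 mod n"
    using assms(1) unfolding induced_cycle_def by blast
  also have "\<dots> \<longleftrightarrow> i = 0 \<or> i = n - 2"
  proof (cases "i = n - 2")
    case True
    then have "Suc (Suc i) = n" using assms(2) by simp
    then show ?thesis using True by simp
  next
    case False
    then have "Suc (Suc i) < n" "Suc i < n" using \<open>i \<le> n - 2\<close> assms(2) by auto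
    then show ?thesis using False by simp
  qed
  finally show "adj (c 0) (c (Suc i)) \<longleftrightarrow> i = 0 \<or> i = n - 2" .
qed

text \<open>After the slide, \<open>c n = c 0\<close> carries the old colour of \<open>c 1\<close>,
  while \<open>c 2\<close> has that of \<open>c (n - 1)\<close> by \<open>ear_ends\<close>. So the
  two cycle neighbours of the token differ again and the step can be iterated.\<close>

lemma induced_cycle_step:
  assumes "induced_cycle c n" "3 \<le> n" "\<phi> \<in> S (c 0)" "\<phi> (c 1) \<noteq> \<phi> (c (n - 1))"
  obtains \<psi> where "\<psi> \<in> S (c 1)" "\<psi> (c 2) \<noteq> \<psi> (c n)"
    "\<mu> (c 0) (c 1) = \<mu> (c (n - 1)) (c n)"
proof -
  let ?q = "\<lambda>i. c (Suc i)"
  have ear: "ear (c 0) ?q (n - 2)" using induced_cycle_ear[OF assms(1,2)] .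
  have n: "Suc (n - 2) = n - 1" using assms(2) by simp
  have c0: "c n = c 0" "c 0 \<noteq> c 1" "c 0 \<noteq> c 2" "adj (c 0) (c 1)"
    using assms(1,2) unfolding induced_cycle_def by auto
  have "\<phi> (?q 0) \<noteq> \<phi> (?q (n - 2))" using assms(4) n by simp
  note ends = ear_ends[OF ear assms(3) this]
  show ?thesis
  proof (rule that)
    show "\<phi>(c 0 := \<phi> (c 1)) \<in> S (c 1)" using slide_adj c0(4) assms(3) by blast
    show "(\<phi>(c 0 := \<phi> (c 1))) (c 2) \<noteq> (\<phi>(c 0 := \<phi> (c 1))) (c n)"
      using ends(2) c0 n assms(4) by (simp add: numeral_2_eq_2)
    show "\<mu> (c 0) (c 1) = \<mu> (c (n - 1)) (c n)" using ends(1) c0(1) n mult_sym by simp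
  qed
qed

lemma induced_cycle_adj:
  assumes "induced_cycle c n" "3 \<le> n" "i < n" "j < n"
  shows "adj (c i) (c j) \<longleftrightarrow> j = Suc i \<or> i = Suc j \<or> Suc i = n \<and> j = 0 \<or> Suc j = n \<and> i = 0"
proof -
  have "Suc i mod n = j \<longleftrightarrow> j = Suc i \<or> Suc i = n \<and> j = 0" if "i < n" "j < n" for i j
    using that by (cases "Suc i = n") auto
  from this[of i j] this[of j i] show ?thesis using assms unfolding induced_cycle_def by auto
qed

text \<open>Recolouring the cycle apart from \<open>c 0\<close> must be invisible from
  \<open>z\<close>, so \<open>z\<close> sees two colours on it, and some arc
  \<open>c a, ..., c b\<close> between consecutive contacts is an ear at \<open>z\<close>. If this
  arc were not all of \<open>c 1, ..., c (n - 1)\<close>, the token could return to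
  \<open>c 0\<close> and run along the cycle to the vertex just before or after the arc, a unique
  contact.\<close>

lemma cycle_contact:
  assumes "induced_cycle c n" "3 \<le> n" "\<phi> \<in> S (c 0)" "\<phi> (c 1) \<noteq> \<phi> (c (n - 1))"
    and "z \<notin> range c" "reach (c ` {1..<n}) (c 0) z" "adj z (c j)" "1 \<le> j" "j < n"
  shows "adj z (c 1) \<and> adj z (c (n - 1)) \<and> (\<forall>m. 1 < m \<longrightarrow> m < n - 1 \<longrightarrow> \<not> adj z (c m))"
proof -
  let ?q = "\<lambda>i. c (Suc i)" and ?D = "c ` {1..<n}"
  have ear: "ear (c 0) ?q (n - 2)" using induced_cycle_ear[OF assms(1,2)] .
  have n: "Suc (n - 2) = n - 1" using assms(2) by simp
  have eq: "c i = c j \<longleftrightarrow> i = j" if "i < n" "j < n" for i j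
    using assms(1) that unfolding induced_cycle_def by simp
  note adjc = induced_cycle_adj[OF assms(1,2)]
  have img: "?q ` {..n - 2} = ?D"
  proof -
    have "{1..<n} = Suc ` {..n - 2}" using assms(2) by (auto simp: image_iff Bex_def) presburger
    then show ?thesis by (simp add: image_image)
  qed
  have "\<phi> (?q 0) \<noteq> \<phi> (?q (n - 2))" using assms(4) n by simp
  then obtain \<phi>' where \<phi>': "\<phi>' \<in> S (c 0)" "\<And>i. i \<le> n - 2 \<Longrightarrow> \<phi>' (?q i) \<noteq> \<phi> (?q i)"
    "\<And>x. \<lbrakk>x \<in> V; x \<notin> ?D; x \<noteq> c 0\<rbrakk> \<Longrightarrow> \<phi> x = \<phi>' x"
    unfolding img[symmetric] by (rule rotate_changes[OF ear assms(3)]) blast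
  note c0 = ear_in[OF ear, unfolded img]
  obtain \<psi> \<psi>' where \<psi>: "\<psi> \<in> S z" "\<psi>' \<in> S z" "\<And>d. d \<in> ?D \<Longrightarrow> \<psi> d = \<phi> d" "\<And>d. d \<in> ?D \<Longrightarrow> \<psi>' d = \<phi>' d"
    "\<And>x. \<lbrakk>x \<in> V; x \<notin> ?D; x \<noteq> z\<rbrakk> \<Longrightarrow> \<psi> x = \<psi>' x"
    using reach_transport[OF assms(6) c0(1,3) assms(3) \<phi>'(1) \<phi>'(3)] by blast
  have diff: "\<psi>' (c i) \<noteq> \<psi> (c i)" if "1 \<le> i" "i < n" for i
    using \<psi>(3,4)[of "c i"] \<phi>'(2)[of "i - 1"] that by simp
  have zV: "z \<in> V" "z \<notin> ?D" using reach_in[OF assms(6) c0(1)] assms(5) by auto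
  \<comment> \<open>The edges from \<open>z\<close> to \<open>c j\<close> have this colour in
    \<open>\<psi>\<close> but not in \<open>\<psi>'\<close>, so in \<open>\<psi>'\<close> another
    neighbour \<open>c m\<close> must have it. In \<open>\<psi>\<close> this \<open>c m\<close> is
    coloured differently, which gives two contacts of different colours in the same state.\<close>
  let ?col = "\<psi> (c j)"
  have "(\<Sum>u\<in>?D. if \<psi> u = ?col then \<mu> z u else 0) = (\<Sum>u\<in>?D. if \<psi>' u = ?col then \<mu> z u else 0)"
    using balanced_on[OF zV \<psi>(1,2) c0(2) \<psi>(5)] .
  moreover have "\<mu> z (c j) \<le> (\<Sum>u\<in>?D. if \<psi> u = ?col then \<mu> z u else 0)"
    using member_le_sum[of "c j" ?D "\<lambda>u. if \<psi> u = ?col then \<mu> z u else 0"] assms(8,9) by simp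
  moreover have "0 < \<mu> z (c j)" using assms(7) by (simp add: adj_def)
  ultimately have "(\<Sum>u\<in>?D. if \<psi>' u = ?col then \<mu> z u else 0) \<noteq> 0" by linarith
  then obtain m where m: "1 \<le> m" "m < n" "\<psi>' (c m) = ?col" "\<mu> z (c m) \<noteq> 0"
    by (auto dest!: sum.not_neutral_contains_not_neutral split: if_splits)
  have am: "adj z (c m)" using m(4) zV(1) assms(1) unfolding adj_def induced_cycle_def by simp
  have "\<psi> (c m) \<noteq> \<psi> (c j)" using diff[OF m(1,2)] m(3) by simp
  then obtain i1 j1 where ij: "i1 < j1" "1 \<le> i1" "j1 < n" "adj z (c i1)" "adj z (c j1)" "\<psi> (c i1) \<noteq> \<psi> (c j1)"
    using am m(1,2) assms(7-9) by (metis linorder_neqE_nat)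
  obtain a b where ab': "i1 \<le> a" "a < b" "b \<le> j1" "adj z (c a)" "adj z (c b)" "\<psi> (c a) \<noteq> \<psi> (c b)"
    "\<And>m. \<lbrakk>a < m; m < b\<rbrakk> \<Longrightarrow> \<not> adj z (c m)"
    by (rule consecutive_differing[of i1 j1 "\<lambda>i. adj z (c i)" "\<lambda>i. \<psi> (c i)"]) (use ij in auto)
  then have ab: "1 \<le> a" "b < n" using ij by auto
  let ?p = "\<lambda>i. c (a + i)"
  have ear2: "ear z ?p (b - a)" unfolding ear_def
  proof (intro conjI allI impI)
    show "0 < b - a" using ab'(2) by simp
    show "inj_on ?p {..b - a}"
    proof (rule inj_onI)
      fix x y assume "x \<in> {..b - a}" "y \<in> {..b - a}" "?p x = ?p y"
      then show "x = y" using eq[of "a + x" "a + y"] ab ab'(2) by auto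
    qed
    show "z \<notin> ?p ` {..b - a}" using assms(5) by blast
    show "adj z (?p i) \<longleftrightarrow> i = 0 \<or> i = b - a" if "i \<le> b - a" for i
      using ab' that by (cases "i = 0 \<or> i = b - a") auto
    show "adj (?p i) (?p (Suc i))" if "i < b - a" for i
      using adjc[of "a + i" "Suc (a + i)"] that ab by simp
  qed
  have img2: "?p ` {..b - a} = c ` {a..b}"
  proof -
    have "{a..b} = (\<lambda>i. a + i) ` {..b - a}" using ab'(2) by (simp add: atMost_atLeast0)
    then show ?thesis by (simp add: image_image)
  qed
  have ends: "\<psi> (?p 0) \<noteq> \<psi> (?p (b - a))" using ab' by simp
  note contact = no_unique_contact[OF ear2 \<psi>(1) ends, unfolded img2]
  have notin: "c i \<notin> c ` {a..b}" if "i < n" "i < a \<or> b < i" for i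
    using eq that ab(2) by auto
  have "reach ?D z (c 0)" using reach_sym[OF assms(6)] c0(3) by blast
  then have z0: "reach (c ` {a..b}) z (c 0)" by (rule reach_mono) (use ab in auto)
  have "b = n - 1"
  proof (rule ccontr)
    assume "b \<noteq> n - 1"
    then have bn: "Suc b < n" using ab by simp
    have "reach (c ` {a..b}) z (c (n - 1))"
      using reach_step[OF z0, of "c (n - 1)"] adjc[of 0 "n - 1"] notin[of "n - 1"] bn
      by (simp add: less_diff_conv)
    then have "reach (c ` {a..b}) z (c (Suc b))"
    proof (rule reach_down)
      show "adj (c i) (c (Suc i))" if "i < n - 1" for i using adjc[of i "Suc i"] that by simp
      show "c i \<notin> c ` {a..b}" if "Suc b \<le> i" "i < n - 1" for i by (rule notin) (use that in auto)
    qed (use bn in simp)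
    then show False
    proof (rule contact)
      show "b - a \<le> b - a" "adj (c (Suc b)) (?p (b - a))"
        using adjc[of "Suc b" b] bn ab'(2) by auto
      fix i assume "i \<le> b - a" "adj (c (Suc b)) (c (a + i))"
      then show "i = b - a" using adjc[of "Suc b" "a + i"] bn ab ab'(2) by auto
    qed
  qed
  moreover have "a = 1"
  proof (rule ccontr)
    assume "a \<noteq> 1"
    then have a1: "2 \<le> a" using ab by simp
    have "reach (c ` {a..b}) z (c (a - 1))"
    proof (rule reach_up[where q = c, OF z0])
      show "adj (c i) (c (Suc i))" if "i < a - 1" for i using adjc[of i "Suc i"] that ab ab'(2) by simp
      show "c i \<notin> c ` {a..b}" if "i \<le> a - 1" for i by (rule notin) (use that a1 ab ab'(2) in auto)
    qed simp
    then show False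
    proof (rule contact)
      show "0 \<le> b - a" "adj (c (a - 1)) (?p 0)"
        using adjc[of "a - 1" a] a1 ab ab'(2) by auto
      fix i assume "i \<le> b - a" "adj (c (a - 1)) (c (a + i))"
      moreover have "a - 1 < n" "a + i < n" using \<open>i \<le> b - a\<close> a1 ab ab'(2) by linarith+
      ultimately show "i = 0" using adjc[of "a - 1" "a + i"] a1 by auto
    qed
  qed
  ultimately show ?thesis using ab' by simp
qed

text \<open>Iterating the step carries the differing neighbours to every position of the token. Each
  position equates the multiplicities of its two cycle edges, so all of them agree.\<close>

lemma induced_cycle_states:
  assumes "induced_cycle c n" "3 \<le> n" "\<phi> \<in> S (c 0)" "\<phi> (c 1) \<noteq> \<phi> (c (n - 1))"
  shows "\<exists>\<psi>\<in>S (c k). \<psi> (c (k + 1)) \<noteq> \<psi> (c (k + (n - 1))) \<and> \<mu> (c k) (c (Suc k)) = \<mu> (c 0) (c 1)"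
proof (induction k)
  case 0
  then show ?case using assms(3,4) by auto
next
  case (Suc k)
  have per: "c (i + n) = c i" for i using assms(1) unfolding induced_cycle_def by simp
  have n: "Suc k + (n - 1) = k + n" "Suc k + 1 = k + 2" "Suc k + 0 = k + 1" using assms(2) by auto
  obtain \<psi> where \<psi>: "\<psi> \<in> S (c (k + 0))" "\<psi> (c (k + 1)) \<noteq> \<psi> (c (k + (n - 1)))"
    "\<mu> (c k) (c (Suc k)) = \<mu> (c 0) (c 1)" using Suc by auto
  obtain \<psi>' where \<psi>': "\<psi>' \<in> S (c (k + 1))" "\<psi>' (c (k + 2)) \<noteq> \<psi>' (c (k + n))"
    using induced_cycle_step[OF induced_cycle_shift[OF assms(1), of k] assms(2) \<psi>(1,2)] by blast
  have a: "\<psi>' \<in> S (c (Suc k + 0))" "\<psi>' (c (Suc k + 1)) \<noteq> \<psi>' (c (Suc k + (n - 1)))"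
    unfolding n by (rule \<psi>')+
  have "\<mu> (c (Suc k + 0)) (c (Suc k + 1)) = \<mu> (c (Suc k + (n - 1))) (c (Suc k + n))"
    using induced_cycle_step[OF induced_cycle_shift[OF assms(1), of "Suc k"] assms(2) a] by blast
  also have "\<dots> = \<mu> (c k) (c (Suc k))" unfolding n(1) using per[of k] per[of "Suc k"] by simp
  finally have "\<mu> (c (Suc k)) (c (Suc (Suc k))) = \<mu> (c 0) (c 1)" using \<psi>(3) by simp
  then show ?case using a by auto
qed

text \<open>A vertex off the cycle leads to a contradiction as follows. The off-cycle vertices
  reachable from some \<open>c i\<close> through off-cycle vertices are non-empty in number, and
  since \<open>c i\<close> does not separate the block, one of them, \<open>z\<close>, has a contact
  other than \<open>c i\<close>. With the token on \<open>c i\<close>, \<open>z\<close> must be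
  joined to \<open>c (i + 1)\<close> and \<open>c (i - 1)\<close> but not to
  \<open>c (i + 2)\<close>, which is distinct from \<open>c (i - 1)\<close> for
  \<open>n \<ge> 5\<close>.\<close>

lemma cycle_spans:
  assumes cross: "\<And>v. v \<in> V \<Longrightarrow> crossing (V - {v})"
    and cyc: "induced_cycle c n" "5 \<le> n" "\<phi> \<in> S (c 0)" "\<phi> (c 1) \<noteq> \<phi> (c (n - 1))"
  shows "V = range c"
proof (rule ccontr)
  assume "V \<noteq> range c"
  have n3: "3 \<le> n" using cyc(2) by simp
  have cV: "c i \<in> V" for i using cyc(1) unfolding induced_cycle_def by simp
  have per: "c (i mod n) = c i" for i using cyc(1) unfolding induced_cycle_def by simp
  have eq: "c i = c j \<longleftrightarrow> i mod n = j mod n" for i j using cyc(1) unfolding induced_cycle_def by simp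
  have shift_range: "range (\<lambda>i. c (k + i)) = range c" for k
  proof
    show "range c \<subseteq> range (\<lambda>i. c (k + i))"
    proof
      fix x assume "x \<in> range c"
      then obtain i where x: "x = c i" by blast
      have "c i = c (i + k * n)" unfolding eq by simp
      also have "i + k * n = k + (i + k * (n - 1))" using n3 by (cases n) auto
      finally show "x \<in> range (\<lambda>i. c (k + i))" using x by blast
    qed
  qed auto
  let ?W = "V - range c"
  have c01: "c 1 \<noteq> c 0" using n3 unfolding eq by simp
  have "\<exists>y\<in>?W. \<exists>i. adj y (c i)"
  proof -
    have "c 1 \<in> V - {c 0}" "c 1 \<notin> ?W" using cV c01 by auto
    then have "?W \<noteq> V - {c 0}" by blast
    moreover have "?W \<subseteq> V - {c 0}" "?W \<noteq> {}" using \<open>V \<noteq> range c\<close> cV by auto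
    ultimately have W: "?W \<subseteq> V - {c 0}" "?W \<noteq> {}" "?W \<noteq> V - {c 0}" by blast+
    obtain y x where "y \<in> ?W" "x \<in> V - {c 0}" "x \<notin> ?W" "adj y x"
      by (rule crossingD[OF cross[OF cV[of 0]] W]) blast
    then show ?thesis by blast
  qed
  then obtain y i where yi: "y \<in> ?W" "adj (c i) y" using adj_sym by blast
  let ?X = "{x \<in> ?W. reach (range c) (c i) x}"
  have yX: "y \<in> ?X" using reach_step[OF reach_refl yi(2)] yi(1) by auto
  have "adj (c i) (c (Suc i))" using cyc(1) unfolding induced_cycle_def by simp
  then have ci: "c (Suc i) \<in> V - {c i}" "c (Suc i) \<notin> ?X" using cV by auto
  have X: "?X \<subseteq> V - {c i}" "?X \<noteq> {}" "?X \<noteq> V - {c i}" using yX ci by auto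
  obtain z x where zx: "z \<in> ?X" "x \<in> V - {c i}" "x \<notin> ?X" "adj z x"
    by (rule crossingD[OF cross[OF cV[of i]] X]) blast
  have "x \<in> range c"
  proof (rule ccontr)
    assume "x \<notin> range c"
    then have "x \<in> ?X" using reach_step[of "range c" "c i" z x] zx adj_in by auto
    then show False using zx(3) by simp
  qed
  then have "x \<in> range (\<lambda>j. c (i + j))" using shift_range by simp
  then obtain m where m: "x = c (i + m)" by blast
  let ?c = "\<lambda>j. c (i + j)" and ?j = "m mod n"
  have cyc': "induced_cycle ?c n" using induced_cycle_shift[OF cyc(1)] .
  have "?c ?j = c (i + m)" using cyc' unfolding induced_cycle_def by simp
  then have j: "adj z (?c ?j)" "?c ?j \<noteq> c i" using zx m by auto
  then have j1: "1 \<le> ?j" "?j < n" using n3 by (auto simp: Suc_le_eq intro!: gr0I)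
  have z: "z \<notin> range c" "z \<notin> range ?c" using zx(1) shift_range by auto
  have "reach (?c ` {1..<n}) (?c 0) z"
    using zx(1) reach_mono[of "range c" "c i" z "?c ` {1..<n}"] by auto
  moreover obtain \<psi> where "\<psi> \<in> S (?c 0)" "\<psi> (?c 1) \<noteq> \<psi> (?c (n - 1))"
    using induced_cycle_states[OF cyc(1) n3 cyc(3,4), of i] by auto
  ultimately have contact: "adj z (?c 1) \<and> adj z (?c (n - 1)) \<and> (\<forall>m. 1 < m \<longrightarrow> m < n - 1 \<longrightarrow> \<not> adj z (?c m))"
    using cycle_contact[OF cyc' n3 _ _ z(2) _ j(1) j1] by blast
  moreover have "1 < (2::nat)" "2 < n - 1" using cyc(2) by auto
  ultimately have first: "adj z (?c 1)" "adj z (?c (n - 1))" "\<not> adj z (?c 2)" by blast+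
  \<comment> \<open>The token now starts on \<open>c (i + 1)\<close>, a neighbour of
    \<open>z\<close>. In this reading index \<open>n - 2\<close> is \<open>c (i - 1)\<close>, a
    contact of \<open>z\<close>, so \<open>cycle_contact\<close> demands index 1, that is
    \<open>c (i + 2)\<close>, as a contact too.\<close>
  let ?d = "\<lambda>j. c (Suc i + j)"
  have cyc'': "induced_cycle ?d n" using induced_cycle_shift[OF cyc(1)] .
  have zd: "z \<notin> range ?d" using z(1) shift_range by metis
  have "reach (?d ` {1..<n}) (?d 0) z"
  proof (rule reach_step[OF reach_refl])
    show "adj (?d 0) z" using first(1) adj_sym[of z] by simp
    show "z \<notin> ?d ` {1..<n}" using zd by blast
  qed
  moreover obtain \<psi>' where "\<psi>' \<in> S (?d 0)" "\<psi>' (?d 1) \<noteq> \<psi>' (?d (n - 1))"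
    using induced_cycle_states[OF cyc(1) n3 cyc(3,4), of "Suc i"] by auto
  moreover have "adj z (?d (n - 2))"
  proof -
    have "Suc i + (n - 2) = i + (n - 1)" using n3 by simp
    then show ?thesis using first(2) by (simp only:)
  qed
  moreover have "1 \<le> n - 2" "n - 2 < n" using n3 by auto
  ultimately have "adj z (?d 1)" using cycle_contact[OF cyc'' n3 _ _ zd] by blast
  then show False using first(3) by simp
qed

section \<open>From chordless ears to complete graphs and odd cycles\<close>

lemma induced_cycleI:
  assumes "0 < n" "\<And>i. i < n \<Longrightarrow> d i \<in> V" "\<And>i j. \<lbrakk>i < n; j < n; d i = d j\<rbrakk> \<Longrightarrow> i = j"
    and "\<And>i j. \<lbrakk>i < n; j < n\<rbrakk> \<Longrightarrow> adj (d i) (d j) \<longleftrightarrow> Suc i mod n = j \<or> Suc j mod n = i"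
  shows "induced_cycle (\<lambda>i. d (i mod n)) n"
  unfolding induced_cycle_def
proof (intro conjI allI)
  fix i j
  show "d (i mod n) \<in> V" using assms(1,2) by simp
  show "d (i mod n) = d (j mod n) \<longleftrightarrow> i mod n = j mod n" using assms(3)[of "i mod n" "j mod n"] assms(1) by auto
  show "adj (d (i mod n)) (d (j mod n)) \<longleftrightarrow> Suc i mod n = j mod n \<or> Suc j mod n = i mod n"
    using assms(4)[of "i mod n" "j mod n"] assms(1) by (simp add: mod_Suc_eq)
qed

text \<open>\<open>case_nat v q\<close> puts the token at index 0 and \<open>q i\<close> at index
  \<open>i + 1\<close>. The premise on the \<open>q i\<close> excludes the chords that an ear may
  have.\<close>

lemma ear_closes_to_cycle:
  assumes "ear v q l" "\<And>i j. \<lbrakk>i \<le> l; j \<le> l\<rbrakk> \<Longrightarrow> adj (q i) (q j) \<longleftrightarrow> i = Suc j \<or> j = Suc i"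
  shows "induced_cycle (\<lambda>i. case_nat v q (i mod (l + 2))) (l + 2)"
proof (rule induced_cycleI)
  have l: "0 < l" and inj: "inj_on q {..l}" and nb: "\<And>i. i \<le> l \<Longrightarrow> adj v (q i) \<longleftrightarrow> i = 0 \<or> i = l"
    using assms(1) unfolding ear_def by auto
  note V = ear_in[OF assms(1)]
  fix i j assume ij: "i < l + 2" "j < l + 2"
  show "case_nat v q i \<in> V" using V ij by (cases i) auto
  show "i = j" if "case_nat v q i = case_nat v q j"
    using that V(3) inj ij by (cases i; cases j) (auto simp: inj_on_def)
  have sm: "Suc x mod (l + 2) = (if x = Suc l then 0 else Suc x)" if "x < l + 2" for x
    using that by (cases "x = Suc l") auto
  show "adj (case_nat v q i) (case_nat v q j) \<longleftrightarrow> Suc i mod (l + 2) = j \<or> Suc j mod (l + 2) = i"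
  proof (cases i)
    case 0
    then show ?thesis using nb[of "j - 1"] sm[OF ij(1)] sm[OF ij(2)] ij l by (cases j) auto
  next
    case i: (Suc i')
    show ?thesis
    proof (cases j)
      case 0
      then show ?thesis using i nb[of i'] sm[OF ij(1)] sm[OF ij(2)] ij l adj_sym[of "q i'" v] by auto
    next
      case (Suc j')
      then show ?thesis using i assms(2)[of i' j'] sm[OF ij(1)] sm[OF ij(2)] ij by auto
    qed
  qed
qed simp

text \<open>A chordless ear with differing ends and more than two vertices closes to a spanning odd
  cycle. If there is none, every ear supplied by \<open>token_ear\<close> closes to a triangle, so
  differently coloured neighbours of the token are adjacent; from this the neighbourhood of each
  vertex other than \<open>v0\<close> is a clique.\<close>

lemma classification:
  assumes cross: "\<And>v. v \<in> V \<Longrightarrow> crossing (V - {v})" and cross_V: "crossing V"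
    and v0: "v0 \<in> V" "V \<noteq> {v0}" and start: "v1 \<in> V" "S v1 \<noteq> {}"
    and two: "\<And>v \<phi>. \<lbrakk>v \<in> V; v \<noteq> v0; \<phi> \<in> S v\<rbrakk> \<Longrightarrow> \<exists>u w. adj v u \<and> adj v w \<and> \<phi> u \<noteq> \<phi> w"
  obtains (complete) t where "\<And>u v. \<lbrakk>u \<in> V; v \<in> V; u \<noteq> v\<rbrakk> \<Longrightarrow> \<mu> u v = t"
  | (cycle) c n where "5 \<le> n" "odd n" "induced_cycle c n" "V = range c"
      "\<And>i. \<mu> (c i) (c (Suc i)) = \<mu> (c 0) (c 1)"
proof (cases "\<exists>v \<phi> q l. 1 < l \<and> \<phi> \<in> S v \<and> ear v q l \<and> \<phi> (q 0) \<noteq> \<phi> (q l) \<and>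
    (\<forall>i\<le>l. \<forall>j\<le>l. adj (q i) (q j) \<longleftrightarrow> i = Suc j \<or> j = Suc i)")
  case True
  then obtain v \<phi> q l where *: "1 < l" "\<phi> \<in> S v" "ear v q l" "\<phi> (q 0) \<noteq> \<phi> (q l)"
    and "\<forall>i\<le>l. \<forall>j\<le>l. adj (q i) (q j) \<longleftrightarrow> i = Suc j \<or> j = Suc i" by (elim exE conjE) (rule that)
  then have ind: "adj (q i) (q j) \<longleftrightarrow> i = Suc j \<or> j = Suc i" if "i \<le> l" "j \<le> l" for i j
    using that by simp
  let ?c = "\<lambda>i. case_nat v q (i mod (l + 2))" and ?n = "l + 2"
  have cyc: "induced_cycle ?c ?n" using ear_closes_to_cycle[OF *(3) ind] .
  have odd: "odd l" using ear_odd[OF *(3,2,4)] .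
  then have n: "5 \<le> ?n" "odd ?n" "3 \<le> ?n" using *(1) by (auto elim: oddE)
  have st: "\<phi> \<in> S (?c 0)" "\<phi> (?c 1) \<noteq> \<phi> (?c (?n - 1))" using *(1,2,4) by auto
  have "V = range ?c" by (rule cycle_spans[OF cross cyc n(1) st])
  moreover have "\<mu> (?c i) (?c (Suc i)) = \<mu> (?c 0) (?c 1)" for i
    using induced_cycle_states[OF cyc n(3) st, of i] by blast
  ultimately show ?thesis using cycle[of ?n ?c] n cyc by blast
next
  case False
  have tri: "\<exists>q. ear v q 1 \<and> q 0 = u \<and> q 1 = w"
    if a: "v \<in> V" "\<phi> \<in> S v" "adj v u" "adj v w" "\<phi> u \<noteq> \<phi> w" for v \<phi> u w
  proof -
    obtain q l where q: "ear v q l" "q 0 = u" "q l = w"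
      "\<And>i j. \<lbrakk>i \<le> l; j \<le> l\<rbrakk> \<Longrightarrow> adj (q i) (q j) \<longleftrightarrow> i = Suc j \<or> j = Suc i"
      using token_ear[OF cross[OF a(1)] a(2-5)] by blast
    then have "\<not> 1 < l" using False a by blast
    moreover have "0 < l" using q(1) unfolding ear_def by simp
    ultimately have "l = 1" by linarith
    then show ?thesis using q by blast
  qed
  have nbrs: "adj u w \<and> \<mu> v u = \<mu> v w \<and> \<mu> u w = \<mu> v u"
    if a: "v \<in> V" "\<phi> \<in> S v" "adj v u" "adj v w" "\<phi> u \<noteq> \<phi> w" for v \<phi> u w
  proof -
    obtain q where q: "ear v q 1" "q 0 = u" "q 1 = w" using tri[OF a] by blast
    have uw: "adj u w" using q unfolding ear_def by auto
    have vw: "\<mu> v u = \<mu> v w" using ear_ends(1)[OF q(1) a(2)] q a(5) by simp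
    \<comment> \<open>The same triangle seen from \<open>u\<close> after one slide: \<open>v\<close>
      now has the old colour of \<open>u\<close>, still different from that of \<open>w\<close>, so
      the two multiplicities at \<open>u\<close> agree as well.\<close>
    let ?\<phi> = "\<phi>(v := \<phi> u)"
    have "?\<phi> \<in> S u" using slide_adj a by blast
    moreover have "?\<phi> v \<noteq> ?\<phi> w" using a by auto
    ultimately obtain p where p: "ear u p 1" "p 0 = v" "p 1 = w" "?\<phi> \<in> S u" "?\<phi> v \<noteq> ?\<phi> w"
      using tri[of u ?\<phi> v w] a(3) uw adj_sym adj_in by metis
    have "\<mu> u v = \<mu> u w" using ear_ends(1)[OF p(1,4)] p(5) unfolding p(2,3) by blast
    then show ?thesis using uw vw mult_sym by metis
  qed
  have nonempty: "S v \<noteq> {}" if "v \<in> V" for v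
  proof (rule ccontr)
    assume "\<not> S v \<noteq> {}"
    let ?X = "{x \<in> V. S x \<noteq> {}}"
    have X: "?X \<subseteq> V" "?X \<noteq> {}" "?X \<noteq> V" using start that \<open>\<not> S v \<noteq> {}\<close> by auto
    obtain y z where yz: "y \<in> ?X" "z \<in> V" "z \<notin> ?X" "adj y z"
      by (rule crossingD[OF cross_V X]) blast
    then obtain \<phi> where "\<phi> \<in> S y" by blast
    then have "S z \<noteq> {}" using slide_adj[OF yz(4)] by blast
    then show False using yz(2,3) by simp
  qed
  have clique: "\<exists>t. (\<forall>u. adj v u \<longrightarrow> \<mu> v u = t) \<and> (\<forall>u u'. adj v u \<longrightarrow> adj v u' \<longrightarrow> u \<noteq> u' \<longrightarrow> adj u u' \<and> \<mu> u u' = t)"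
    if v: "v \<in> V" "v \<noteq> v0" for v
  proof -
    obtain \<phi> where \<phi>: "\<phi> \<in> S v" using nonempty v by blast
    obtain x y where xy: "adj v x" "adj v y" "\<phi> x \<noteq> \<phi> y" using two[OF v \<phi>] by blast
    have t: "\<mu> v u = \<mu> v x" if "adj v u" for u
      using nbrs[OF v(1) \<phi> that xy(1)] nbrs[OF v(1) \<phi> that xy(2)] nbrs[OF v(1) \<phi> xy] xy(3) by metis
    have "adj u u' \<and> \<mu> u u' = \<mu> v x" if u: "adj v u" "adj v u'" "u \<noteq> u'" for u u'
    proof (cases "\<phi> u = \<phi> u'")
      case False
      then show ?thesis using nbrs[OF v(1) \<phi> u(1,2)] t u by simp
    next
      case True
      \<comment> \<open>For neighbours \<open>u\<close>, \<open>u'\<close> of equal colour, rotating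
        a triangle through \<open>u\<close> and a vertex \<open>w\<close> of another colour
        recolours \<open>u\<close> but not \<open>u'\<close>, and the case of different colours
        applies.\<close>
      obtain w where w: "adj v w" "\<phi> u \<noteq> \<phi> w" using xy by metis
      obtain q where q: "ear v q 1" "q 0 = u" "q 1 = w" using tri[OF v(1) \<phi> u(1) w] by blast
      obtain \<phi>' where \<phi>': "\<phi>' \<in> S v" "\<And>i. i < 1 \<Longrightarrow> \<phi>' (q i) = \<phi> (q (Suc i))"
        "\<And>x. \<lbrakk>x \<noteq> v; x \<notin> q ` {..1}\<rbrakk> \<Longrightarrow> \<phi>' x = \<phi> x" by (rule rotate[OF q(1) \<phi>]) blast
      have "u' \<noteq> w" using True w by auto
      then have "u' \<notin> q ` {..1}" using u(3) q by (auto simp: atMost_Suc)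
      moreover have "u' \<noteq> v" using u(2) by auto
      ultimately have "\<phi>' u' = \<phi> u'" using \<phi>'(3) by blast
      then have "\<phi>' u \<noteq> \<phi>' u'" using \<phi>'(2)[of 0] q w(2) True by simp
      then show ?thesis using nbrs[OF v(1) \<phi>'(1) u(1,2)] t u by simp
    qed
    then show ?thesis using t by blast
  qed
  obtain x where x: "x \<in> V" "x \<noteq> v0" using v0 by blast
  have near: "y = x \<or> adj x y" if y: "y \<in> V" "y \<noteq> v0" for y
  proof (rule ccontr)
    \<comment> \<open>The closed neighbourhood of \<open>x\<close> off \<open>v0\<close> has no edge
      leaving it in \<open>V - {v0}\<close>: for an edge from a neighbour \<open>a\<close> of
      \<open>x\<close> to \<open>b\<close>, the clique around \<open>a\<close> contains both
      \<open>x\<close> and \<open>b\<close>.\<close>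
    let ?X = "{y \<in> V - {v0}. y = x \<or> adj x y}"
    assume "\<not> ?thesis"
    then have X: "?X \<subseteq> V - {v0}" "?X \<noteq> {}" "?X \<noteq> V - {v0}" using x y by auto
    obtain a b where ab: "a \<in> ?X" "b \<in> V - {v0}" "b \<notin> ?X" "adj a b"
      by (rule crossingD[OF cross[OF v0(1)] X]) blast
    then have "a \<noteq> x" "b \<noteq> x" by auto
    then have "adj a x" using ab(1) adj_sym by blast
    then show False using clique[of a] ab \<open>b \<noteq> x\<close> by blast
  qed
  have all0: "adj y z" if "y \<in> V" "y \<noteq> v0" "z \<in> V" "z \<noteq> v0" "y \<noteq> z" for y z
    using near[OF that(1,2)] near[OF that(3,4)] clique[OF x] that(5) adj_sym by blast
  have "{v0} \<subseteq> V" "{v0} \<noteq> {}" "{v0} \<noteq> V" using v0 by auto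
  then obtain y where y: "y \<in> V" "adj v0 y" "y \<noteq> v0"
    by (rule crossingD[OF cross_V]) blast
  \<comment> \<open>No clique statement is available at \<open>v0\<close> itself. It is used at a
    neighbour \<open>y\<close> of \<open>v0\<close>, whose neighbourhood contains \<open>v0\<close>
    and, unless \<open>y = x\<close>, also \<open>x\<close>.\<close>
  have "adj x v0"
    using clique[OF y(1,3)] all0[OF y(1,3) x] y(2) adj_sym x(2) by metis
  then have adjx: "adj x z" if "z \<in> V" "z \<noteq> x" for z using near that by blast
  obtain t where t: "\<And>u. adj x u \<Longrightarrow> \<mu> x u = t" "\<And>u u'. \<lbrakk>adj x u; adj x u'; u \<noteq> u'\<rbrakk> \<Longrightarrow> \<mu> u u' = t"
    using clique[OF x] by blast
  have "\<mu> u v = t" if "u \<in> V" "v \<in> V" "u \<noteq> v" for u v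
    using that t adjx mult_sym[of u v] by metis
  then show ?thesis using complete by blast
qed

end

section \<open>Colourings with degenerate classes\<close>

text \<open>For \<open>r > 0\<close> this is the usual \<open>(r - 1)\<close>-degeneracy of the
  induced subhypergraph. The formulation by subsets lets a critical subhypergraph contradict it
  directly.\<close>

definition degenerate :: "('v, 'e) hgraph \<Rightarrow> nat \<Rightarrow> 'v set \<Rightarrow> bool" where
  "degenerate H r X \<longleftrightarrow> (\<forall>K\<subseteq>X. K \<noteq> {} \<longrightarrow> (\<exists>v\<in>K. degree (induced H K) v < r))"

definition partial_coloring ::
    "('v, 'e) hgraph \<Rightarrow> nat \<Rightarrow> ('v \<Rightarrow> 'c set) \<Rightarrow> 'v set \<Rightarrow> ('v \<Rightarrow> 'c) \<Rightarrow> bool" where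
  "partial_coloring H r L X \<phi> \<longleftrightarrow>
     (\<forall>v\<in>X. \<phi> v \<in> L v) \<and> (\<forall>c. degenerate H r {v \<in> X. \<phi> v = c})"

text \<open>The obstruction to giving \<open>v\<close> the colour \<open>c\<close>. An edge with an
  uncoloured vertex besides \<open>v\<close> obstructs no colour.\<close>

definition mono_edges :: "('v, 'e) hgraph \<Rightarrow> 'v set \<Rightarrow> ('v \<Rightarrow> 'c) \<Rightarrow> 'v \<Rightarrow> 'c \<Rightarrow> 'e set" where
  "mono_edges H X \<phi> v c = {e \<in> edges H. v \<in> inc H e \<and> inc H e - {v} \<subseteq> {u \<in> X. \<phi> u = c}}"

lemma degree_induced: "degree (induced H K) v = card {e \<in> edges H. inc H e \<subseteq> K \<and> v \<in> inc H e}"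
  unfolding degree_def induced_def by (rule arg_cong[of _ _ card]) auto

lemma hypergraphD:
  assumes "hypergraph H"
  shows "finite (verts H)" "finite (edges H)" "e \<in> edges H \<Longrightarrow> inc H e \<subseteq> verts H"
    "e \<in> edges H \<Longrightarrow> 2 \<le> card (inc H e)" "e \<in> edges H \<Longrightarrow> finite (inc H e)"
  using assms unfolding hypergraph_def by (auto intro: finite_subset)

lemma edge_other_vertex:
  assumes "hypergraph H" "e \<in> edges H"
  shows "inc H e - {v} \<noteq> {}"
proof
  assume "inc H e - {v} = {}"
  then have "inc H e \<subseteq> {v}" by auto
  then have "card (inc H e) \<le> 1" using card_mono[of "{v}"] by auto
  then show False using hypergraphD(4)[OF assms] by simp
qed

lemma degenerate_mono: "\<lbrakk>degenerate H r X; Y \<subseteq> X\<rbrakk> \<Longrightarrow> degenerate H r Y"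
  unfolding degenerate_def by (meson order_trans)

lemma partial_coloring_subset:
  assumes "partial_coloring H r L X \<phi>" "Y \<subseteq> X"
  shows "partial_coloring H r L Y \<phi>"
proof -
  have "degenerate H r {v \<in> Y. \<phi> v = c}" for c
    by (rule degenerate_mono[of H r "{v \<in> X. \<phi> v = c}"]) (use assms in \<open>auto simp: partial_coloring_def\<close>)
  then show ?thesis using assms unfolding partial_coloring_def by auto
qed

text \<open>A set \<open>K\<close> containing \<open>v\<close> has \<open>v\<close> itself as a
  vertex of small degree, since all edges of \<open>K\<close> at \<open>v\<close> are among the
  obstructions; any other \<open>K\<close> lies in an old class.\<close>

lemma partial_coloring_insert:
  assumes "hypergraph H" "partial_coloring H r L X \<phi>" "v \<notin> X" "c \<in> L v" "card (mono_edges H X \<phi> v c) < r"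
  shows "partial_coloring H r L (insert v X) (\<phi>(v := c))"
  unfolding partial_coloring_def
proof (intro conjI allI ballI)
  fix u assume "u \<in> insert v X"
  then show "(\<phi>(v := c)) u \<in> L u" using assms(2,4) unfolding partial_coloring_def by auto
next
  fix d
  have old: "degenerate H r {u \<in> X. \<phi> u = d}" using assms(2) unfolding partial_coloring_def by auto
  show "degenerate H r {u \<in> insert v X. (\<phi>(v := c)) u = d}"
    unfolding degenerate_def
  proof (intro allI impI)
    fix K assume K: "K \<subseteq> {u \<in> insert v X. (\<phi>(v := c)) u = d}" "K \<noteq> {}"
    show "\<exists>u\<in>K. degree (induced H K) u < r"
    proof (cases "v \<in> K")
      case False
      then have "K \<subseteq> {u \<in> X. \<phi> u = d}" using K(1) by auto
      then show ?thesis using old K(2) unfolding degenerate_def by blast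
    next
      case True
      then have d: "d = c" using K(1) by auto
      have "{e \<in> edges H. inc H e \<subseteq> K \<and> v \<in> inc H e} \<subseteq> mono_edges H X \<phi> v c"
        using K(1) d by (fastforce simp: mono_edges_def)
      moreover have "finite (mono_edges H X \<phi> v c)"
        using hypergraphD(2)[OF assms(1)] by (simp add: mono_edges_def)
      ultimately have "degree (induced H K) v \<le> card (mono_edges H X \<phi> v c)"
        unfolding degree_induced by (simp add: card_mono)
      then have "degree (induced H K) v < r" using assms(5) by linarith
      then show ?thesis using True by blast
    qed
  qed
qed

text \<open>Every edge has a vertex other than \<open>v\<close>, whose colour decides which
  obstruction the edge belongs to.\<close>

lemma card_mono_edges:
  assumes "hypergraph H" "finite C"
  shows "(\<Sum>c\<in>C. card (mono_edges H X \<phi> v c)) = card (\<Union>c\<in>C. mono_edges H X \<phi> v c)"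
proof (rule card_UN_disjoint[symmetric])
  show "finite C" using assms(2) .
  show "\<forall>c\<in>C. finite (mono_edges H X \<phi> v c)"
    using hypergraphD(2)[OF assms(1)] by (simp add: mono_edges_def)
  show "\<forall>c\<in>C. \<forall>d\<in>C. c \<noteq> d \<longrightarrow> mono_edges H X \<phi> v c \<inter> mono_edges H X \<phi> v d = {}"
    using edge_other_vertex[OF assms(1), of _ v] by (fastforce simp: mono_edges_def)
qed

text \<open>Pigeonhole: if each colour in \<open>L v\<close> were blocked by \<open>r\<close> edges,
  these disjoint families would exhaust more edges than are available.\<close>

lemma partial_coloring_extend:
  assumes "hypergraph H" "partial_coloring H r L X \<phi>" "v \<notin> X" "finite (L v)"
    and "card {e \<in> edges H. v \<in> inc H e \<and> inc H e - {v} \<subseteq> X} < r * card (L v)"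
  shows "\<exists>c. partial_coloring H r L (insert v X) (\<phi>(v := c))"
proof (rule ccontr)
  assume "\<not> ?thesis"
  then have "r \<le> card (mono_edges H X \<phi> v c)" if "c \<in> L v" for c
    using partial_coloring_insert[OF assms(1-3) that] by fastforce
  then have "r * card (L v) \<le> (\<Sum>c\<in>L v. card (mono_edges H X \<phi> v c))"
    using sum_bounded_below[of "L v" r "\<lambda>c. card (mono_edges H X \<phi> v c)"] by (simp add: mult.commute)
  also have "\<dots> \<le> card {e \<in> edges H. v \<in> inc H e \<and> inc H e - {v} \<subseteq> X}"
    unfolding card_mono_edges[OF assms(1,4)]
    by (rule card_mono) (use hypergraphD(2)[OF assms(1)] in \<open>auto simp: mono_edges_def\<close>)
  finally show False using assms(5) by simp
qed

lemma partial_coloring_empty: "partial_coloring H r L {} \<phi>"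
  by (simp add: partial_coloring_def degenerate_def)

lemma greedy_coloring:
  assumes "hypergraph H" "\<And>v. v \<in> verts H \<Longrightarrow> finite (L v) \<and> degree H v < r * card (L v)"
  shows "\<exists>\<phi>. partial_coloring H r L (verts H) \<phi>"
proof -
  have "\<exists>\<phi>. partial_coloring H r L X \<phi>" if "finite X" "X \<subseteq> verts H" for X
    using that
  proof (induction X)
    case empty
    show ?case using partial_coloring_empty by blast
  next
    case (insert v X)
    then obtain \<phi> where "partial_coloring H r L X \<phi>" by auto
    moreover have "card {e \<in> edges H. v \<in> inc H e \<and> inc H e - {v} \<subseteq> X} \<le> degree H v"
      unfolding degree_def by (rule card_mono) (use hypergraphD(2)[OF assms(1)] in auto)
    ultimately show ?case
      using partial_coloring_extend[OF assms(1), of r L X \<phi> v] assms(2)[of v] insert by auto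
  qed
  then show ?thesis using hypergraphD(1)[OF assms(1)] by blast
qed

lemma connected_crossing_edge:
  assumes "connected_hg H" "X \<subseteq> verts H" "X \<noteq> {}" "X \<noteq> verts H"
  obtains e where "e \<in> edges H" "inc H e \<inter> X \<noteq> {}" "\<not> inc H e \<subseteq> X"
proof -
  obtain u w where uw: "u \<in> X" "w \<in> verts H" "w \<notin> X" using assms(2-4) by blast
  then obtain vs es where p: "hyperpath H vs es" "hd vs = u" "last vs = w"
    using assms(1,2) unfolding connected_hg_def by blast
  then have len: "length vs = Suc (length es)"
    and edge: "\<And>j. j < length es \<Longrightarrow> es ! j \<in> edges H \<and> vs ! j \<in> inc H (es ! j) \<and> vs ! Suc j \<in> inc H (es ! j)"
    unfolding hyperpath_def by (auto simp: subset_iff)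
  have "vs \<noteq> []" using len by auto
  then have ends: "vs ! 0 \<in> X" "vs ! length es \<notin> X"
    using p uw len by (auto simp: hd_conv_nth last_conv_nth)
  have "\<exists>j<length es. vs ! j \<in> X \<and> vs ! Suc j \<notin> X"
  proof (rule ccontr)
    assume n: "\<not> ?thesis"
    have "vs ! j \<in> X" if "j \<le> length es" for j
      using that by (induction j) (use ends(1) n in auto)
    then show False using ends(2) by simp
  qed
  then show ?thesis using edge that by blast
qed

section \<open>Lists of critical size without a colouring\<close>

locale tight_lists =
  fixes H :: "('v, 'e) hgraph" and L :: "'v \<Rightarrow> 'c set" and r k :: nat
  assumes hyp: "hypergraph H" and connected: "connected_hg H" and r_pos: "0 < r" and k_pos: "0 < k"
    and lists: "v \<in> verts H \<Longrightarrow> finite (L v) \<and> card (L v) = k"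
    and degree_le: "v \<in> verts H \<Longrightarrow> degree H v \<le> r * k"
    and uncolorable: "\<not> partial_coloring H r L (verts H) \<phi>"
begin

abbreviation "V \<equiv> verts H"
abbreviation "E \<equiv> edges H"
abbreviation "I \<equiv> inc H"

definition token :: "'v \<Rightarrow> ('v \<Rightarrow> 'c) \<Rightarrow> bool" where
  "token v \<phi> \<longleftrightarrow> partial_coloring H r L (V - {v}) \<phi>"

text \<open>\<open>B\<close> is a set of vertices still to be coloured, such that any colouring off
  \<open>B\<close> leads to a token state at \<open>v\<close>. A maximal such \<open>B\<close> is
  \<open>V\<close>, where the empty colouring can be used.\<close>

lemma exists_token:
  assumes "v \<in> V"
  obtains \<phi> where "token v \<phi>"
proof -
  let ?P = "{B. v \<in> B \<and> B \<subseteq> V \<and> (\<forall>\<phi>. partial_coloring H r L (V - B) \<phi> \<longrightarrow> (\<exists>\<psi>. token v \<psi>))}"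
  have fin: "finite ?P" by (rule finite_subset[of _ "Pow V"]) (use hypergraphD(1)[OF hyp] in auto)
  have "{v} \<in> ?P" using assms by (auto simp: token_def)
  then have "?P \<noteq> {}" by blast
  from finite_has_maximal[OF fin this]
  obtain B where B: "B \<in> ?P" "\<forall>B'\<in>?P. B \<subseteq> B' \<longrightarrow> B = B'" by (elim bexE) (rule that)
  have "B = V"
  proof (rule ccontr)
    assume "B \<noteq> V"
    have "B \<subseteq> V" "B \<noteq> {}" using B(1) by auto
    then obtain e where e: "e \<in> E" "I e \<inter> B \<noteq> {}" "\<not> I e \<subseteq> B"
      by (rule connected_crossing_edge[OF connected _ _ \<open>B \<noteq> V\<close>])
    then obtain x where x: "x \<in> I e" "x \<notin> B" by blast
    have xV: "x \<in> V" using hypergraphD(3)[OF hyp] e(1) x(1) by blast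
    have "insert x B \<in> ?P"
    proof (intro CollectI conjI allI impI)
      show "v \<in> insert x B" "insert x B \<subseteq> V" using B(1) xV by auto
      fix \<phi> assume pc: "partial_coloring H r L (V - insert x B) \<phi>"
      \<comment> \<open>The edge \<open>e\<close> meets the uncoloured set \<open>B\<close> and
        obstructs nothing at \<open>x\<close>, so fewer than \<open>r * k\<close> edges count and a
        colour remains for \<open>x\<close>.\<close>
      have "{e \<in> E. x \<in> I e \<and> I e - {x} \<subseteq> V - insert x B} \<subset> {e \<in> E. x \<in> I e}"
        using e x by blast
      then have "card {e \<in> E. x \<in> I e \<and> I e - {x} \<subseteq> V - insert x B} < degree H x"
        unfolding degree_def by (rule psubset_card_mono[rotated]) (use hypergraphD(2)[OF hyp] in simp)
      also have "\<dots> \<le> r * card (L x)" using degree_le lists xV by simp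
      finally obtain c where "partial_coloring H r L (insert x (V - insert x B)) (\<phi>(x := c))"
        using partial_coloring_extend[OF hyp pc, of x] lists xV by auto
      moreover have "insert x (V - insert x B) = V - B" using xV x(2) by auto
      ultimately show "\<exists>\<psi>. token v \<psi>" using B(1) by auto
    qed
    then have "B = insert x B" by (rule B(2)[rule_format]) blast
    then show False using x(2) by blast
  qed
  then obtain \<psi> where "token v \<psi>" using B(1) partial_coloring_empty[of H r L] by fastforce
  then show ?thesis by (rule that)
qed

text \<open>Each of the \<open>k\<close> colours is blocked by at least \<open>r\<close> disjointly
  counted edges, while the degree is at most \<open>r * k\<close>; equality holds
  everywhere.\<close>

lemma token_edges:
  assumes "token v \<phi>" "v \<in> V"
  shows "c \<in> L v \<Longrightarrow> card (mono_edges H (V - {v}) \<phi> v c) = r"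
    and "(\<Union>c\<in>L v. mono_edges H (V - {v}) \<phi> v c) = {e \<in> E. v \<in> I e}"
    and "degree H v = r * k"
proof -
  let ?M = "mono_edges H (V - {v}) \<phi> v"
  have fin: "finite (L v)" "card (L v) = k" using lists assms(2) by auto
  have ge: "r \<le> card (?M c)" if "c \<in> L v" for c
  proof (rule ccontr)
    assume "\<not> ?thesis"
    then have "partial_coloring H r L (insert v (V - {v})) (\<phi>(v := c))"
      using partial_coloring_insert[of H r L "V - {v}" \<phi> v c] hyp assms(1) that unfolding token_def by auto
    moreover have "insert v (V - {v}) = V" using assms(2) by auto
    ultimately show False using uncolorable by simp
  qed
  have sub: "(\<Union>c\<in>L v. ?M c) \<subseteq> {e \<in> E. v \<in> I e}" by (auto simp: mono_edges_def)
  have finE: "finite {e \<in> E. v \<in> I e}" using hypergraphD(2)[OF hyp] by simp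
  have "r * k \<le> (\<Sum>c\<in>L v. card (?M c))"
    using sum_bounded_below[of "L v" r "\<lambda>c. card (?M c)"] ge fin(2) by (simp add: mult.commute)
  moreover have "(\<Sum>c\<in>L v. card (?M c)) = card (\<Union>c\<in>L v. ?M c)" by (rule card_mono_edges[OF hyp fin(1)])
  moreover have "card (\<Union>c\<in>L v. ?M c) \<le> degree H v" unfolding degree_def by (rule card_mono[OF finE sub])
  moreover note degree_le[OF assms(2)]
  ultimately have eq: "(\<Sum>c\<in>L v. card (?M c)) = r * k" "card (\<Union>c\<in>L v. ?M c) = degree H v" "degree H v = r * k"
    by linarith+
  show "degree H v = r * k" by (rule eq(3))
  show "(\<Union>c\<in>L v. ?M c) = {e \<in> E. v \<in> I e}"
    using card_subset_eq[OF finE sub] eq(2) unfolding degree_def by simp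
  show "card (?M c) = r" if "c \<in> L v"
  proof (rule ccontr)
    assume "card (?M c) \<noteq> r"
    then have "r < card (?M c)" using ge[OF that] by simp
    then have "(\<Sum>c\<in>L v. r) < (\<Sum>c\<in>L v. card (?M c))"
      using sum_strict_mono_ex1[OF fin(1), of "\<lambda>_. r" "\<lambda>c. card (?M c)"] ge that by blast
    then show False using eq(1) fin(2) by (simp add: mult.commute)
  qed
qed

lemma token_edge_color:
  assumes "token v \<phi>" "e \<in> E" "v \<in> I e"
  obtains c where "c \<in> L v" "I e - {v} \<subseteq> {u \<in> V - {v}. \<phi> u = c}"
proof -
  have "v \<in> V" using hypergraphD(3)[OF hyp] assms by blast
  then have "e \<in> (\<Union>c\<in>L v. mono_edges H (V - {v}) \<phi> v c)" using token_edges(2)[OF assms(1)] assms(2,3) by blast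
  then show ?thesis using that unfolding mono_edges_def by blast
qed

lemma token_color_edge:
  assumes "token v \<phi>" "v \<in> V" "c \<in> L v"
  obtains e where "e \<in> E" "v \<in> I e" "I e - {v} \<subseteq> {u \<in> V - {v}. \<phi> u = c}"
proof -
  have "mono_edges H (V - {v}) \<phi> v c \<noteq> {}" using token_edges(1)[OF assms] r_pos by auto
  then show ?thesis using that unfolding mono_edges_def by blast
qed

text \<open>Uncolouring \<open>b\<close> removes \<open>e\<close> from the exactly \<open>r\<close>
  edges that block the colour of \<open>b\<close> at \<open>v\<close>, so \<open>v\<close> can take
  that colour.\<close>

lemma token_slide:
  assumes "token v \<phi>" "e \<in> E" "v \<in> I e" "b \<in> I e" "b \<noteq> v"
  shows "token b (\<phi>(v := \<phi> b))"
proof -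
  have V: "v \<in> V" "b \<in> V" using hypergraphD(3)[OF hyp] assms by blast+
  obtain c where c: "c \<in> L v" "I e - {v} \<subseteq> {u \<in> V - {v}. \<phi> u = c}" using token_edge_color[OF assms(1-3)] .
  then have b: "\<phi> b = c" using assms by blast
  let ?X = "V - {v} - {b}"
  have pc: "partial_coloring H r L ?X \<phi>"
    by (rule partial_coloring_subset[OF assms(1)[unfolded token_def]]) blast
  have "mono_edges H ?X \<phi> v c \<subset> mono_edges H (V - {v}) \<phi> v c"
  proof
    show "mono_edges H ?X \<phi> v c \<subseteq> mono_edges H (V - {v}) \<phi> v c" by (auto simp: mono_edges_def)
    have "e \<in> mono_edges H (V - {v}) \<phi> v c" using c(2) assms by (simp add: mono_edges_def)
    moreover have "e \<notin> mono_edges H ?X \<phi> v c" using assms by (auto simp: mono_edges_def)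
    ultimately show "mono_edges H ?X \<phi> v c \<noteq> mono_edges H (V - {v}) \<phi> v c" by blast
  qed
  then have "card (mono_edges H ?X \<phi> v c) < card (mono_edges H (V - {v}) \<phi> v c)"
    by (rule psubset_card_mono[rotated]) (use hypergraphD(2)[OF hyp] in \<open>simp add: mono_edges_def\<close>)
  also have "\<dots> = r" using token_edges(1)[OF assms(1) V(1) c(1)] .
  finally have "partial_coloring H r L (insert v ?X) (\<phi>(v := c))"
    using partial_coloring_insert[OF hyp pc] c(1) by blast
  moreover have "insert v ?X = V - {b}" using V assms(5) by auto
  ultimately show ?thesis using b by (simp add: token_def)
qed

lemma regular: "v \<in> V \<Longrightarrow> degree H v = r * k"
  using exists_token[of v] token_edges(3)[of v] by blast

lemma verts_nonempty: "V \<noteq> {}"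
  using uncolorable partial_coloring_empty[of H r L] by auto

end

section \<open>End blocks\<close>

text \<open>
  A gate separates a set \<open>A\<close> from the rest of the hypergraph. The minimal gates are the end blocks;
  working with a minimal gate instead of blocks avoids the block decomposition.
\<close>

context tight_lists
begin

definition gate :: "'v set \<Rightarrow> 'v \<Rightarrow> bool" where
  "gate A v \<longleftrightarrow> v \<in> A \<and> A \<noteq> {v} \<and> A \<subseteq> V \<and> (\<forall>e\<in>E. I e \<inter> (A - {v}) \<noteq> {} \<longrightarrow> I e \<subseteq> A)"

text \<open>\<open>V\<close> with any of its vertices is a gate: positive degrees supply a second
  vertex. Minimality is by cardinality over all pairs.\<close>

lemma minimal_gate_exists:
  obtains A v where "gate A v" "\<And>A' v'. gate A' v' \<Longrightarrow> card A \<le> card A'"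
proof -
  obtain v where v: "v \<in> V" using verts_nonempty by blast
  have "card {e \<in> E. v \<in> I e} \<noteq> 0" using regular[OF v] r_pos k_pos unfolding degree_def by simp
  then have "{e \<in> E. v \<in> I e} \<noteq> {}" by (metis card.empty)
  then obtain e where e: "e \<in> E" "v \<in> I e" by blast
  then have "V \<noteq> {v}" using edge_other_vertex[OF hyp e(1), of v] hypergraphD(3)[OF hyp e(1)] by blast
  then have "gate V v" using v hypergraphD(3)[OF hyp] unfolding gate_def by auto
  then have "(\<lambda>(A, v). gate A v) (V, v)" by simp
  from ex_has_least_nat[of "\<lambda>(A, v). gate A v" _ "\<lambda>(A, v). card A", OF this]
  obtain A w where "gate A w" "\<forall>y. (case y of (A, v) \<Rightarrow> gate A v) \<longrightarrow> card A \<le> (case y of (A, v) \<Rightarrow> card A)"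
    by auto
  then show ?thesis using that[of A w] by fastforce
qed

end

section \<open>Connectivity and edge size in a minimal gate\<close>

locale tight_block = tight_lists +
  fixes A :: "'a set" and v0 :: 'a and \<phi>0 :: "'a \<Rightarrow> 'c"
  assumes gate: "gate A v0" and minimal: "gate A' v' \<Longrightarrow> card A \<le> card A'"
    and two_le_k: "2 \<le> k" and token_v0: "token v0 \<phi>0"
begin

lemma gateD: "v0 \<in> A" "A \<noteq> {v0}" "A \<subseteq> V" "\<lbrakk>e \<in> E; v \<in> I e; v \<in> A; v \<noteq> v0\<rbrakk> \<Longrightarrow> I e \<subseteq> A"
  using gate unfolding gate_def by blast+

lemma finite_A: "finite A"
  using gateD(3) hypergraphD(1)[OF hyp] finite_subset by blast

text \<open>Either \<open>X\<close> or its complement in \<open>A - {v}\<close> avoids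
  \<open>v0\<close>. If no edge left that part except towards \<open>v\<close>, the part together
  with \<open>v\<close> would be a smaller gate.\<close>

lemma crossing_edge:
  assumes "v \<in> A" "X \<subseteq> A - {v}" "X \<noteq> {}" "X \<noteq> A - {v}"
  obtains e y z where "e \<in> E" "I e \<subseteq> A" "y \<in> I e" "y \<in> X" "z \<in> I e" "z \<in> A - {v} - X"
proof -
  have main: "\<exists>e\<in>E. I e \<subseteq> A \<and> I e \<inter> Y \<noteq> {} \<and> \<not> I e \<subseteq> insert v Y"
    if Y: "Y \<subseteq> A - {v}" "Y \<noteq> {}" "Y \<noteq> A - {v}" "v0 \<notin> Y" for Y
  proof (rule ccontr)
    assume n: "\<not> ?thesis"
    have "gate (insert v Y) v" unfolding gate_def
    proof (intro conjI ballI impI)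
      show "v \<in> insert v Y" "insert v Y \<noteq> {v}" "insert v Y \<subseteq> V" using Y assms(1) gateD(3) by auto
      fix e assume e: "e \<in> E" "I e \<inter> (insert v Y - {v}) \<noteq> {}"
      then obtain y where y: "y \<in> I e" "y \<in> Y" by blast
      then have "I e \<subseteq> A" using gateD(4)[OF e(1) y(1)] Y by blast
      then show "I e \<subseteq> insert v Y" using n e(1) y by blast
    qed
    then have "card A \<le> card (insert v Y)" by (rule minimal)
    moreover have "insert v Y \<subset> A" using Y assms(1) by blast
    then have "card (insert v Y) < card A" by (rule psubset_card_mono[OF finite_A])
    ultimately show False by simp
  qed
  have "\<exists>e\<in>E. I e \<subseteq> A \<and> I e \<inter> X \<noteq> {} \<and> I e \<inter> (A - {v} - X) \<noteq> {}"
  proof (cases "v0 \<in> X")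
    case False
    then show ?thesis using main[OF assms(2-4)] by blast
  next
    case True
    let ?Y = "A - {v} - X"
    have "?Y \<subseteq> A - {v}" "?Y \<noteq> {}" "?Y \<noteq> A - {v}" "v0 \<notin> ?Y" using assms True by auto
    from main[OF this] show ?thesis by blast
  qed
  then show ?thesis using that by blast
qed

text \<open>Here connectedness of \<open>H\<close> supplies the edge: one that meets a part of
  \<open>A\<close> without \<open>v0\<close> stays inside \<open>A\<close>.\<close>

lemma crossing_edge_A:
  assumes "X \<subseteq> A" "X \<noteq> {}" "X \<noteq> A"
  obtains e y z where "e \<in> E" "I e \<subseteq> A" "y \<in> I e" "y \<in> X" "z \<in> I e" "z \<in> A - X"
proof -
  have main: "\<exists>e\<in>E. I e \<subseteq> A \<and> I e \<inter> Y \<noteq> {} \<and> \<not> I e \<subseteq> Y" if Y: "Y \<subseteq> A" "Y \<noteq> {}" "v0 \<notin> Y" for Y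
  proof -
    have YV: "Y \<subseteq> V" "Y \<noteq> V" using Y(1,3) gateD(1,3) by auto
    obtain e where e: "e \<in> E" "I e \<inter> Y \<noteq> {}" "\<not> I e \<subseteq> Y"
      by (rule connected_crossing_edge[OF connected YV(1) Y(2) YV(2)]) blast
    then have "I e \<subseteq> A" using gateD(4)[OF e(1)] Y by blast
    then show ?thesis using e by blast
  qed
  have "\<exists>e\<in>E. I e \<subseteq> A \<and> I e \<inter> X \<noteq> {} \<and> I e \<inter> (A - X) \<noteq> {}"
  proof (cases "v0 \<in> X")
    case False
    then show ?thesis using main[OF assms(1,2)] by blast
  next
    case True
    then have "A - X \<subseteq> A" "A - X \<noteq> {}" "v0 \<notin> A - X" using assms by auto
    from main[OF this] show ?thesis by blast
  qed
  then show ?thesis using that by blast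
qed

text \<open>
  If an edge \<open>e\<close> at \<open>v\<close> had two further vertices, let the token leave \<open>v\<close> through an edge of another
  colour and come back to \<open>e\<close> avoiding \<open>v\<close>: on arrival \<open>e\<close> shows two different colours.
\<close>

lemma edge_size:
  assumes e: "e \<in> E" "I e \<subseteq> A"
  shows "card (I e) = 2"
proof (rule ccontr)
  assume "card (I e) \<noteq> 2"
  then have big: "3 \<le> card (I e)" using hypergraphD(4)[OF hyp e(1)] by simp
  have finI: "finite (I e)" using hypergraphD(5)[OF hyp e(1)] .
  obtain v where v: "v \<in> I e" "v \<noteq> v0" using edge_other_vertex[OF hyp e(1), of v0] by blast
  have vA: "v \<in> A" "v \<in> V" using v(1) e(2) gateD(3) by auto
  obtain \<phi> where \<phi>: "token v \<phi>" by (rule exists_token[OF vA(2)])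
  obtain c where c: "c \<in> L v" "I e - {v} \<subseteq> {u \<in> V - {v}. \<phi> u = c}"
    by (rule token_edge_color[OF \<phi> e(1) v(1)])
  have "\<not> L v \<subseteq> {c}"
  proof
    assume "L v \<subseteq> {c}"
    then have "card (L v) \<le> 1" using card_mono[of "{c}"] by fastforce
    then show False using lists[OF vA(2)] two_le_k by simp
  qed
  then obtain d where d: "d \<in> L v" "d \<noteq> c" by blast
  obtain f where f: "f \<in> E" "v \<in> I f" "I f - {v} \<subseteq> {u \<in> V - {v}. \<phi> u = d}"
    by (rule token_color_edge[OF \<phi> vA(2) d(1)])
  obtain x where x: "x \<in> I f" "x \<noteq> v" using edge_other_vertex[OF hyp f(1), of v] by blast
  have xA: "x \<in> A" using gateD(4)[OF f(1,2) vA(1) v(2)] x(1) by blast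
  have xc: "\<phi> x = d" using f(3) x by blast
  \<comment> \<open>Token positions off \<open>e\<close> that keep the conflict on \<open>e\<close>
    alive. A slide out of this set that avoids \<open>v\<close> has to land on
    \<open>e\<close>.\<close>
  let ?X = "{y \<in> A - I e. \<exists>\<psi>. token y \<psi> \<and> \<psi> v = d \<and> (\<forall>b\<in>I e - {v}. \<psi> b = c)}"
  have "x \<in> ?X"
  proof -
    have "token x (\<phi>(v := \<phi> x))" using token_slide[OF \<phi> f(1,2) x] .
    moreover have "x \<notin> I e" using c(2) x(2) xc d(2) by blast
    moreover have "\<forall>b\<in>I e - {v}. (\<phi>(v := \<phi> x)) b = c" using c(2) by auto
    moreover have "(\<phi>(v := \<phi> x)) v = d" using xc by simp
    ultimately show ?thesis using xA by blast
  qed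
  moreover have "I e - {v} \<noteq> {}" using edge_other_vertex[OF hyp e(1)] .
  ultimately have X: "?X \<subseteq> A - {v}" "?X \<noteq> {}" "?X \<noteq> A - {v}" using v(1) e(2) by blast+
  obtain g y z where g: "g \<in> E" "I g \<subseteq> A" "y \<in> I g" "y \<in> ?X" "z \<in> I g" "z \<in> A - {v} - ?X"
    by (rule crossing_edge[OF vA(1) X]) blast
  obtain \<psi> where \<psi>: "token y \<psi>" "\<psi> v = d" "\<forall>b\<in>I e - {v}. \<psi> b = c" using g(4) by blast
  have "y \<noteq> z" using g(4,6) by blast
  let ?\<psi> = "\<psi>(y := \<psi> z)"
  have t: "token z ?\<psi>" using token_slide[OF \<psi>(1) g(1,3,5)] \<open>y \<noteq> z\<close> by simp
  have y: "y \<notin> I e" using g(4) by blast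
  then have e': "?\<psi> v = d" "\<forall>b\<in>I e - {v}. ?\<psi> b = c" using \<psi>(2,3) v(1) by auto
  have "z \<in> I e"
  proof (rule ccontr)
    assume "z \<notin> I e"
    then have "z \<in> ?X" using t e' g(6) by blast
    then show False using g(6) by blast
  qed
  then obtain c' where c': "I e - {z} \<subseteq> {u \<in> V - {z}. ?\<psi> u = c'}"
    by (rule token_edge_color[OF t e(1)])
  have "card (I e - {v} - {z}) \<noteq> 0" using big v(1) \<open>z \<in> I e\<close> g(6) finI by simp
  then obtain b where b: "b \<in> I e" "b \<noteq> v" "b \<noteq> z" by (metis DiffE card.empty ex_in_conv singletonI)
  have "?\<psi> b = c'" using c' b by blast
  moreover have "?\<psi> v = c'" using c' v(1) g(6) by blast
  ultimately show False using e' b d(2) by auto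
qed

section \<open>The multigraph of the gate and its token states\<close>

definition mult :: "'a \<Rightarrow> 'a \<Rightarrow> nat" where
  "mult u w = card {e \<in> E. I e = {u, w}}"

text \<open>The colours outside \<open>A\<close> are frozen to those of \<open>\<phi>0\<close>. Only
  then do the edges that leave \<open>A\<close> at \<open>v0\<close> contribute a constant to each
  colour count.\<close>

definition states :: "'a \<Rightarrow> ('a \<Rightarrow> 'c) set" where
  "states v = {\<phi>. token v \<phi> \<and> (\<forall>x\<in>V - A. \<phi> x = \<phi>0 x)}"

lemma mult_pos: "0 < mult u w \<longleftrightarrow> (\<exists>e\<in>E. I e = {u, w})"
  unfolding mult_def using hypergraphD(2)[OF hyp] by (auto simp: card_gt_0_iff)

text \<open>By \<open>edge_size\<close> an edge in \<open>A\<close> at \<open>v\<close> has exactly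
  one further vertex \<open>u\<close>, so it is counted once, in \<open>mult v u\<close>.\<close>

lemma mult_sum:
  assumes "v \<in> A"
  shows "(\<Sum>u\<in>A. if p u then mult v u else 0) = card {e \<in> E. v \<in> I e \<and> I e \<subseteq> A \<and> (\<forall>u\<in>I e - {v}. p u)}"
proof -
  let ?F = "\<lambda>u. {e \<in> E. I e = {v, u}}" and ?U = "{u \<in> A - {v}. p u}"
  have "I e \<noteq> {v, v}" if "e \<in> E" for e using edge_other_vertex[OF hyp that, of v] by auto
  then have zero: "mult v v = 0" unfolding mult_def by (simp add: card_eq_0_iff)
  have "(\<Sum>u\<in>A. if p u then mult v u else 0) = (\<Sum>u\<in>?U. if p u then mult v u else 0)"
    by (rule sum.mono_neutral_right) (use finite_A zero in auto)
  also have "\<dots> = (\<Sum>u\<in>?U. card (?F u))" by (simp add: mult_def)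
  also have "\<dots> = card (\<Union>u\<in>?U. ?F u)"
    by (rule card_UN_disjoint[symmetric])
      (use finite_A hypergraphD(2)[OF hyp] in \<open>auto simp: doubleton_eq_iff\<close>)
  also have "(\<Union>u\<in>?U. ?F u) = {e \<in> E. v \<in> I e \<and> I e \<subseteq> A \<and> (\<forall>u\<in>I e - {v}. p u)}" (is "?l = ?r")
  proof
    show "?l \<subseteq> ?r" using assms by auto
    show "?r \<subseteq> ?l"
    proof
      fix e assume e: "e \<in> ?r"
      then have "card (I e) = 2" using edge_size by blast
      then obtain a b where ab: "I e = {a, b}" "a \<noteq> b" unfolding card_2_iff by blast
      then obtain u where "I e = {v, u}" "u \<noteq> v" using e by auto
      then show "e \<in> ?l" using e by auto
    qed
  qed
  finally show ?thesis .
qed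

lemma outside_edge:
  assumes "e \<in> E" "v \<in> I e" "v \<in> A" "\<not> I e \<subseteq> A"
  shows "I e - {v} \<subseteq> V - A"
  using gateD(4)[OF assms(1)] assms hypergraphD(3)[OF hyp assms(1)] by blast

text \<open>The edges blocking \<open>c\<close> at \<open>v\<close> number \<open>r\<close> or 0,
  and those leaving \<open>A\<close> depend on \<open>\<phi>0\<close> alone. So the count inside
  \<open>A\<close> is the same for all states with the token on \<open>v\<close>, which is the axiom
  \<open>balanced\<close>.\<close>

lemma mono_edges_split:
  assumes "\<phi> \<in> states v" "v \<in> A"
  shows "(\<Sum>u\<in>A. if \<phi> u = c then mult v u else 0) +
    card {e \<in> E. v \<in> I e \<and> \<not> I e \<subseteq> A \<and> (\<forall>u\<in>I e - {v}. \<phi>0 u = c)} = (if c \<in> L v then r else 0)"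
proof -
  let ?M = "mono_edges H (V - {v}) \<phi> v c"
  let ?in = "{e \<in> E. v \<in> I e \<and> I e \<subseteq> A \<and> (\<forall>u\<in>I e - {v}. \<phi> u = c)}"
  let ?out = "{e \<in> E. v \<in> I e \<and> \<not> I e \<subseteq> A \<and> (\<forall>u\<in>I e - {v}. \<phi>0 u = c)}"
  have v: "v \<in> V" using assms(2) gateD(3) by blast
  have t: "token v \<phi>" "\<And>x. x \<in> V - A \<Longrightarrow> \<phi> x = \<phi>0 x" using assms(1) unfolding states_def by auto
  have fin: "finite ?in" "finite ?out" using hypergraphD(2)[OF hyp] by auto
  have "?M = {e \<in> E. v \<in> I e \<and> (\<forall>u\<in>I e - {v}. \<phi> u = c)}"
    using hypergraphD(3)[OF hyp] unfolding mono_edges_def by blast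
  also have "\<dots> = ?in \<union> {e \<in> E. v \<in> I e \<and> \<not> I e \<subseteq> A \<and> (\<forall>u\<in>I e - {v}. \<phi> u = c)}" by blast
  also have "{e \<in> E. v \<in> I e \<and> \<not> I e \<subseteq> A \<and> (\<forall>u\<in>I e - {v}. \<phi> u = c)} = ?out"
  proof (intro Collect_cong conj_cong refl ball_cong)
    fix e u assume "e \<in> E" "v \<in> I e" "\<not> I e \<subseteq> A" "u \<in> I e - {v}"
    then have "u \<in> V - A" using outside_edge assms(2) by blast
    then show "(\<phi> u = c) = (\<phi>0 u = c)" using t(2) by simp
  qed
  finally have M: "?M = ?in \<union> ?out" .
  have "card ?M = card ?in + card ?out" unfolding M by (rule card_Un_disjoint) (use fin in auto)
  moreover have "card ?M = (if c \<in> L v then r else 0)"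
  proof (cases "c \<in> L v")
    case True
    then show ?thesis using token_edges(1)[OF t(1) v] by simp
  next
    case False
    have "?M = {}"
    proof (rule ccontr)
      assume "?M \<noteq> {}"
      then obtain e where e: "e \<in> E" "v \<in> I e" "I e - {v} \<subseteq> {u \<in> V - {v}. \<phi> u = c}"
        unfolding mono_edges_def by blast
      obtain d where "d \<in> L v" "I e - {v} \<subseteq> {u \<in> V - {v}. \<phi> u = d}"
        by (rule token_edge_color[OF t(1) e(1,2)])
      then show False using e(3) edge_other_vertex[OF hyp e(1), of v] False by blast
    qed
    then show ?thesis using False by simp
  qed
  ultimately show ?thesis unfolding mult_sum[OF assms(2)] by simp
qed

sublocale block: sliding A mult states
proof
  show "finite A" by (rule finite_A)
  show "mult u v = mult v u" for u v unfolding mult_def by (simp add: insert_commute)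
  show "mult v v = 0" for v
    using edge_other_vertex[OF hyp, of _ v] unfolding mult_def by (auto simp: card_eq_0_iff)
  fix v
  assume v: "v \<in> A"
  show "\<phi>(v := \<phi> u) \<in> states u" if u: "u \<in> A" "0 < mult v u" "\<phi> \<in> states v" for u \<phi>
  proof -
    obtain e where e: "e \<in> E" "I e = {v, u}" using u(2) mult_pos by blast
    then have "u \<noteq> v" using edge_other_vertex[OF hyp e(1), of v] by auto
    then show ?thesis using token_slide[of v \<phi> e u] e u(3) v unfolding states_def by auto
  qed
  show "(\<Sum>u\<in>A. if \<phi> u = c then mult v u else 0) = (\<Sum>u\<in>A. if \<phi>' u = c then mult v u else 0)"
    if "\<phi> \<in> states v" "\<phi>' \<in> states v" for \<phi> \<phi>' c
    using mono_edges_split[OF that(1) v, of c] mono_edges_split[OF that(2) v, of c] by linarith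
qed

lemma block_adj: "block.adj u w \<longleftrightarrow> u \<in> A \<and> w \<in> A \<and> (\<exists>e\<in>E. I e = {u, w})"
  unfolding block.adj_def mult_pos ..

lemma edge_adj:
  assumes "e \<in> E" "I e \<subseteq> A" "y \<in> I e" "z \<in> I e" "y \<noteq> z"
  shows "block.adj y z"
proof -
  have "I e = {y, z}" using edge_size[OF assms(1,2)] assms(3-5) by (auto simp: card_2_iff)
  then show ?thesis using assms unfolding block_adj by blast
qed

lemma crossing_block: "v \<in> A \<Longrightarrow> block.crossing (A - {v})"
  unfolding block.crossing_def
proof (intro allI impI)
  fix X assume "v \<in> A" and X: "X \<subseteq> A - {v}" "X \<noteq> {}" "X \<noteq> A - {v}"
  from \<open>v \<in> A\<close> X obtain e y z where e: "e \<in> E" "I e \<subseteq> A" "y \<in> I e" "y \<in> X" "z \<in> I e" "z \<in> A - {v} - X"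
    by (rule crossing_edge) blast
  then have "block.adj y z" using edge_adj[OF e(1-3,5)] by blast
  then show "\<exists>y\<in>X. \<exists>z\<in>A - {v} - X. block.adj y z" using e by blast
qed

lemma crossing_A: "block.crossing A"
  unfolding block.crossing_def
proof (intro allI impI)
  fix X assume X: "X \<subseteq> A" "X \<noteq> {}" "X \<noteq> A"
  from X obtain e y z where e: "e \<in> E" "I e \<subseteq> A" "y \<in> I e" "y \<in> X" "z \<in> I e" "z \<in> A - X"
    by (rule crossing_edge_A) blast
  then have "block.adj y z" using edge_adj[OF e(1-3,5)] by blast
  then show "\<exists>y\<in>X. \<exists>z\<in>A - X. block.adj y z" using e by blast
qed

lemma color_neighbour:
  assumes "v \<in> A" "v \<noteq> v0" "token v \<phi>" "c \<in> L v"
  obtains u where "block.adj v u" "\<phi> u = c"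
proof -
  have "v \<in> V" using assms(1) gateD(3) by blast
  obtain e where e: "e \<in> E" "v \<in> I e" "I e - {v} \<subseteq> {u \<in> V - {v}. \<phi> u = c}"
    by (rule token_color_edge[OF assms(3) \<open>v \<in> V\<close> assms(4)])
  obtain u where u: "u \<in> I e" "u \<noteq> v" using edge_other_vertex[OF hyp e(1), of v] by blast
  have "block.adj v u" using edge_adj[OF e(1) gateD(4)[OF e(1,2) assms(1,2)] e(2) u(1)] u(2) by simp
  then show ?thesis using that e(3) u by blast
qed

lemma two_colors:
  assumes "v \<in> A" "v \<noteq> v0" "\<phi> \<in> states v"
  shows "\<exists>u w. block.adj v u \<and> block.adj v w \<and> \<phi> u \<noteq> \<phi> w"
proof -
  have v: "v \<in> V" using assms(1) gateD(3) by blast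
  have t: "token v \<phi>" using assms(3) unfolding states_def by simp
  have "\<not> (\<exists>c. L v \<subseteq> {c})"
  proof
    assume "\<exists>c. L v \<subseteq> {c}"
    then obtain c where "L v \<subseteq> {c}" by blast
    then have "card (L v) \<le> 1" using card_mono[of "{c}"] by fastforce
    then show False using lists[OF v] two_le_k by simp
  qed
  then obtain c d where cd: "c \<in> L v" "d \<in> L v" "c \<noteq> d" by blast
  obtain u where "block.adj v u" "\<phi> u = c" by (rule color_neighbour[OF assms(1,2) t cd(1)])
  moreover obtain w where "block.adj v w" "\<phi> w = d" by (rule color_neighbour[OF assms(1,2) t cd(2)])
  ultimately show ?thesis using cd(3) by blast
qed

section \<open>Degrees in the gate and the shape of the whole hypergraph\<close>

definition block_degree :: "'a \<Rightarrow> nat" where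
  "block_degree v = (\<Sum>u\<in>A. mult v u)"

lemma block_degree_eq: "v \<in> A \<Longrightarrow> block_degree v = card {e \<in> E. v \<in> I e \<and> I e \<subseteq> A}"
  using mult_sum[of v "\<lambda>_. True"] by (simp add: block_degree_def)

lemma block_degree_inner:
  assumes "v \<in> A" "v \<noteq> v0"
  shows "block_degree v = r * k"
proof -
  have "{e \<in> E. v \<in> I e \<and> I e \<subseteq> A} = {e \<in> E. v \<in> I e}" using gateD(4) assms by blast
  then show ?thesis using block_degree_eq[OF assms(1)] regular[of v] assms(1) gateD(3)
    unfolding degree_def by auto
qed

text \<open>Full degree inside \<open>A\<close> leaves no edge at \<open>v0\<close> that exits
  \<open>A\<close>, and no other vertex of \<open>A\<close> has such an edge.\<close>

lemma regular_block_whole: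
  assumes "block_degree v0 = r * k"
  shows "A = V"
proof (rule ccontr)
  assume "A \<noteq> V"
  have fin: "finite {e \<in> E. v0 \<in> I e}" using hypergraphD(2)[OF hyp] by simp
  have "card {e \<in> E. v0 \<in> I e \<and> I e \<subseteq> A} = card {e \<in> E. v0 \<in> I e}"
    using assms block_degree_eq[OF gateD(1)] regular[of v0] gateD(1,3) unfolding degree_def by auto
  then have *: "{e \<in> E. v0 \<in> I e \<and> I e \<subseteq> A} = {e \<in> E. v0 \<in> I e}"
    by (intro card_subset_eq[OF fin]) auto
  have "A \<noteq> {}" using gateD(1) by blast
  obtain e where e: "e \<in> E" "I e \<inter> A \<noteq> {}" "\<not> I e \<subseteq> A"
    by (rule connected_crossing_edge[OF connected gateD(3) \<open>A \<noteq> {}\<close> \<open>A \<noteq> V\<close>]) blast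
  then show False using * gateD(4)[OF e(1)] by blast
qed

end

context tight_lists
begin

theorem complete_or_odd_cycle:
  assumes "2 \<le> k"
  obtains (complete) t where "1 \<le> t" "t * (card V - 1) = r * k" "\<And>e. e \<in> E \<Longrightarrow> card (I e) = 2"
      "\<And>u v. \<lbrakk>u \<in> V; v \<in> V; u \<noteq> v\<rbrakk> \<Longrightarrow> card {e \<in> E. I e = {u, v}} = t"
  | (cycle) c n where "k = 2" "3 \<le> n" "odd n" "V = range c" "\<And>i j. c i = c j \<longleftrightarrow> i mod n = j mod n"
      "\<And>e. e \<in> E \<Longrightarrow> \<exists>i. I e = {c i, c (Suc i)}"
      "\<And>i. card {e \<in> E. I e = {c i, c (Suc i)}} = r"
proof -
  obtain A v0 where A: "gate A v0" "\<And>A' v'. gate A' v' \<Longrightarrow> card A \<le> card A'"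
    by (rule minimal_gate_exists) blast
  then have "v0 \<in> V" unfolding gate_def by blast
  then obtain \<phi>0 where \<phi>0: "token v0 \<phi>0" by (rule exists_token)
  interpret tight_block H L r k A v0 \<phi>0
    by unfold_locales (use A assms \<phi>0 in auto)
  have start: "\<phi>0 \<in> states v0" using \<phi>0 unfolding states_def by simp
  obtain v where v: "v \<in> A" "v \<noteq> v0" using gateD(1,2) by blast
  from start have ne: "states v0 \<noteq> {}" by blast
  show ?thesis
  proof (rule block.classification[OF crossing_block crossing_A gateD(1,2) gateD(1) ne two_colors])
    fix t assume t: "\<And>u w. \<lbrakk>u \<in> A; w \<in> A; u \<noteq> w\<rbrakk> \<Longrightarrow> mult u w = t"
    have deg: "block_degree u = t * (card A - 1)" if u: "u \<in> A" for u
    proof -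
      have "block_degree u = (\<Sum>w\<in>A - {u}. mult u w)"
        unfolding block_degree_def using sum.remove[OF finite_A u, of "mult u"] block.mult_irrefl by simp
      also have "\<dots> = (\<Sum>w\<in>A - {u}. t)" by (rule sum.cong) (use t u in auto)
      finally show ?thesis using finite_A u by (simp add: mult.commute)
    qed
    have rk: "t * (card A - 1) = r * k" using deg[OF v(1)] block_degree_inner[OF v] by simp
    then have AV: "A = V" using regular_block_whole deg[OF gateD(1)] by simp
    have "1 \<le> t" using rk r_pos k_pos by (cases t) auto
    then show ?thesis
    proof (rule complete)
      show "t * (card V - 1) = r * k" using rk AV by simp
      show "card (I e) = 2" if "e \<in> E" for e
        using edge_size[OF that] hypergraphD(3)[OF hyp that] AV by simp
      show "card {e \<in> E. I e = {u, w}} = t" if "u \<in> V" "w \<in> V" "u \<noteq> w" for u w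
        using t that AV unfolding mult_def by simp
    qed
  next
    fix c n
    assume n: "5 \<le> n" "odd n" and cyc: "block.induced_cycle c n" and range: "A = range c"
      and mult: "\<And>i. mult (c i) (c (Suc i)) = mult (c 0) (c 1)"
    let ?t = "mult (c 0) (c 1)"
    have per: "c i = c j \<longleftrightarrow> i mod n = j mod n" for i j using cyc unfolding block.induced_cycle_def by simp
    have nbr: "w = c (i + 1) \<or> w = c (i + (n - 1))" if adj: "block.adj (c i) w" for i w
    proof -
      obtain j where j: "w = c j" using block.adj_in[OF adj] range by blast
      then have "Suc i mod n = j mod n \<or> Suc j mod n = i mod n"
        using adj cyc unfolding block.induced_cycle_def by simp
      then show ?thesis
      proof
        assume "Suc j mod n = i mod n"
        then have "(Suc j + (n - 1)) mod n = (i + (n - 1)) mod n" by (metis mod_add_left_eq)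
        moreover have "Suc j + (n - 1) = j + n" using n by simp
        ultimately have "j mod n = (i + (n - 1)) mod n" by simp
        then show ?thesis using j per by blast
      next
        assume "Suc i mod n = j mod n"
        then show ?thesis using j per[of "i + 1" j] by simp
      qed
    qed
    have deg: "block_degree (c i) = 2 * ?t" for i
    proof -
      have "block_degree (c i) = (\<Sum>w\<in>{c (i + 1), c (i + (n - 1))}. mult (c i) w)"
        unfolding block_degree_def
      proof (rule sum.mono_neutral_right[OF finite_A])
        show "{c (i + 1), c (i + (n - 1))} \<subseteq> A" using range by blast
        have "mult (c i) w = 0" if "w \<in> A" "w \<notin> {c (i + 1), c (i + (n - 1))}" for w
          using nbr[of i w] that range unfolding block.adj_def by auto
        then show "\<forall>w\<in>A - {c (i + 1), c (i + (n - 1))}. mult (c i) w = 0" by blast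
      qed
      also have "\<dots> = mult (c i) (c (i + 1)) + mult (c i) (c (i + (n - 1)))"
      proof -
        have "c (i + 1) \<noteq> c (i + (n - 1))"
        proof
          assume "c (i + 1) = c (i + (n - 1))"
          then have "1 mod n = (n - 1) mod n"
            using block.induced_cycle_shift[OF cyc, of i] unfolding block.induced_cycle_def by blast
          then show False using n by simp
        qed
        then show ?thesis by simp
      qed
      also have "mult (c i) (c (i + (n - 1))) = ?t"
      proof -
        have "Suc (i + (n - 1)) = i + n" using n by simp
        then have "c (Suc (i + (n - 1))) = c i" using per by simp
        then show ?thesis using mult[of "i + (n - 1)"] block.mult_sym[of "c i"] by simp
      qed
      finally show ?thesis using mult[of i] by simp
    qed
    obtain i where i: "v = c i" using v(1) range by blast
    obtain i0 where i0: "v0 = c i0" using gateD(1) range by blast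
    have rk: "2 * ?t = r * k" using deg[of i] block_degree_inner[OF v] i by simp
    then have AV: "A = V" using regular_block_whole deg[of i0] i0 by simp
    have vV: "v \<in> V" using v(1) AV by simp
    obtain \<phi> where \<phi>: "token v \<phi>" by (rule exists_token[OF vV])
    \<comment> \<open>Every colour of the list occurs on a neighbour of the token, and a cycle
      vertex has only two neighbours. Thus \<open>k = 2\<close>, and \<open>2 * ?t = r * k\<close>
      makes the multiplicity \<open>r\<close>.\<close>
    have "L v \<subseteq> \<phi> ` {c (i + 1), c (i + (n - 1))}"
    proof
      fix d assume "d \<in> L v"
      then obtain u where "block.adj v u" "\<phi> u = d" by (rule color_neighbour[OF v \<phi>])
      then show "d \<in> \<phi> ` {c (i + 1), c (i + (n - 1))}" using nbr[of i u] i by blast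
    qed
    then have "card (L v) \<le> card (\<phi> ` {c (i + 1), c (i + (n - 1))})" by (rule card_mono[rotated]) simp
    also have "\<dots> \<le> 2" by (simp add: card_insert_if)
    finally have k: "k = 2" using lists[OF vV] assms by simp
    then have tr: "?t = r" using rk by simp
    from k show ?thesis
    proof (rule cycle)
      show "3 \<le> n" "odd n" "V = range c" "\<And>i j. c i = c j \<longleftrightarrow> i mod n = j mod n"
        using n range AV per by auto
      show "card {e \<in> E. I e = {c i, c (Suc i)}} = r" for i
        using mult[of i] tr unfolding mult_def by simp
      fix e assume e: "e \<in> E"
      then have sub: "I e \<subseteq> A" using hypergraphD(3)[OF hyp] AV by simp
      then have "card (I e) = 2" using edge_size e by blast
      then obtain a b where ab: "I e = {a, b}" "a \<noteq> b" unfolding card_2_iff by blast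
      then have adj: "block.adj a b" using edge_adj[OF e sub, of a b] by simp
      obtain ia ib where "a = c ia" "b = c ib" using ab(1) sub range by blast
      then have "a = c ia \<and> b = c ib \<and> (Suc ia mod n = ib mod n \<or> Suc ib mod n = ia mod n)"
        using adj cyc unfolding block.induced_cycle_def by simp
      then have "b = c (Suc ia) \<or> a = c (Suc ib)" "a = c ia" "b = c ib" using per[of "Suc ia" ib] per[of "Suc ib" ia] by auto
      then show "\<exists>i. I e = {c i, c (Suc i)}" using ab(1) by (metis insert_commute)
    qed
  qed
qed

end

section \<open>Hypergraph properties\<close>

text \<open>The parallel edges over each \<open>s\<close> are numbered by a bijection
  \<open>h s\<close> onto \<open>{..<t}\<close>, which supplies the second component of the edge
  map.\<close>

lemma isomorphic_multipleI:
  fixes H :: "('v, 'e) hgraph" and G :: "('w, 'w set) hgraph"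
  assumes "finite (edges H)" "bij_betw f (verts H) (verts G)" "inc G = id"
    and "\<And>e. e \<in> edges H \<Longrightarrow> f ` inc H e \<in> edges G"
    and "\<And>s. s \<in> edges G \<Longrightarrow> card {e \<in> edges H. f ` inc H e = s} = t"
  shows "isomorphic H (multiple t G)"
proof -
  let ?F = "\<lambda>s. {e \<in> edges H. f ` inc H e = s}"
  have "\<forall>s. \<exists>h. bij_betw h (?F s) {0..<card (?F s)}"
    by (intro allI ex_bij_betw_finite_nat) (use assms(1) in simp)
  from choice[OF this] obtain h where h: "\<And>s. bij_betw (h s) (?F s) {0..<card (?F s)}" by blast
  have h': "bij_betw (h s) (?F s) {..<t}" if "s \<in> edges G" for s
    using h[of s] assms(5)[OF that] by (simp add: atLeast0LessThan)
  define g where "g = (\<lambda>e. (f ` inc H e, h (f ` inc H e) e))"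
  have "bij_betw g (edges H) (edges G \<times> {..<t})"
    unfolding bij_betw_def
  proof
    show "inj_on g (edges H)"
    proof (rule inj_onI)
      fix e e' assume e: "e \<in> edges H" "e' \<in> edges H" "g e = g e'"
      then have "f ` inc H e = f ` inc H e'" "h (f ` inc H e) e = h (f ` inc H e) e'"
        by (auto simp: g_def)
      moreover have "inj_on (h (f ` inc H e)) (?F (f ` inc H e))" using h bij_betw_def by blast
      ultimately show "e = e'" using e(1,2) by (auto simp: inj_on_def)
    qed
    show "g ` edges H = edges G \<times> {..<t}"
    proof
      show "g ` edges H \<subseteq> edges G \<times> {..<t}"
      proof
        fix x assume "x \<in> g ` edges H"
        then obtain e where e: "e \<in> edges H" "x = g e" by blast
        have s: "f ` inc H e \<in> edges G" using assms(4) e(1) .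
        have "h (f ` inc H e) e \<in> {..<t}" using bij_betwE[OF h'[OF s]] e(1) by blast
        then show "x \<in> edges G \<times> {..<t}" using e(2) s by (simp add: g_def)
      qed
      show "edges G \<times> {..<t} \<subseteq> g ` edges H"
      proof
        fix x assume "x \<in> edges G \<times> {..<t}"
        then obtain s j where x: "x = (s, j)" "s \<in> edges G" "j \<in> {..<t}" by blast
        then have "j \<in> h s ` ?F s" using h'[OF x(2)] unfolding bij_betw_def by simp
        then obtain e where "e \<in> edges H" "f ` inc H e = s" "j = h s e" by blast
        then show "x \<in> g ` edges H" using x(1) by (auto simp: g_def)
      qed
    qed
  qed
  then show ?thesis unfolding isomorphic_def multiple_def
    using assms(2,3) by (intro exI[of _ f] exI[of _ g]) (auto simp: g_def)
qed

lemma isomorphic_complete: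
  assumes "hypergraph H" "\<And>e. e \<in> edges H \<Longrightarrow> card (inc H e) = 2"
    and "\<And>u v. \<lbrakk>u \<in> verts H; v \<in> verts H; u \<noteq> v\<rbrakk> \<Longrightarrow> card {e \<in> edges H. inc H e = {u, v}} = t"
  shows "isomorphic H (multiple t (complete_hg (card (verts H))))"
proof -
  obtain f where f: "bij_betw f (verts H) {0..<card (verts H)}"
    using ex_bij_betw_finite_nat[OF hypergraphD(1)[OF assms(1)]] by blast
  then have inj: "inj_on f (verts H)" and img: "f ` verts H = {..<card (verts H)}"
    by (auto simp: bij_betw_def)
  note sub = hypergraphD(3)[OF assms(1)]
  show ?thesis
  proof (rule isomorphic_multipleI)
    show "finite (edges H)" using hypergraphD(2)[OF assms(1)] .
    show "bij_betw f (verts H) (verts (complete_hg (card (verts H))))"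
      using f by (simp add: complete_hg_def atLeast0LessThan)
    show "inc (complete_hg (card (verts H))) = id" by (simp add: complete_hg_def)
  next
    fix e assume e: "e \<in> edges H"
    have "card (f ` inc H e) = 2" using card_image[OF inj_on_subset[OF inj sub[OF e]]] assms(2)[OF e] by simp
    then show "f ` inc H e \<in> edges (complete_hg (card (verts H)))"
      using sub[OF e] img by (auto simp: complete_hg_def)
  next
    fix s assume "s \<in> edges (complete_hg (card (verts H)))"
    then have s: "s \<subseteq> f ` verts H" "card s = 2" using img by (auto simp: complete_hg_def)
    then obtain a b where "s = {a, b}" "a \<noteq> b" unfolding card_2_iff by blast
    then obtain u v where uv: "u \<in> verts H" "v \<in> verts H" "u \<noteq> v" "s = f ` {u, v}" using s(1) by auto
    have "{e \<in> edges H. f ` inc H e = s} = {e \<in> edges H. inc H e = {u, v}}"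
      using inj_on_image_eq_iff[OF inj sub, of _ "{u, v}"] uv by auto
    then show "card {e \<in> edges H. f ` inc H e = s} = t" using assms(3)[OF uv(1-3)] by simp
  qed
qed

lemma isomorphic_cycle:
  assumes "hypergraph H" "0 < n" "verts H = range c" "\<And>i j. c i = c j \<longleftrightarrow> i mod n = j mod n"
    and "\<And>e. e \<in> edges H \<Longrightarrow> \<exists>i. inc H e = {c i, c (Suc i)}"
    and "\<And>i. card {e \<in> edges H. inc H e = {c i, c (Suc i)}} = t"
  shows "isomorphic H (multiple t (cycle_hg n))"
proof -
  \<comment> \<open>The index chosen for \<open>v\<close> is determined up to multiples of
    \<open>n\<close>, so its residue does not depend on the choice.\<close>
  define f where "f v = (SOME i. c i = v) mod n" for v
  have fc: "f (c i) = i mod n" for i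
  proof -
    have "c (SOME j. c j = c i) = c i" by (rule someI) simp
    then show ?thesis unfolding f_def assms(4) .
  qed
  have inj: "inj_on f (verts H)" unfolding assms(3) by (auto simp: inj_on_def fc assms(4))
  note sub = hypergraphD(3)[OF assms(1)]
  show ?thesis
  proof (rule isomorphic_multipleI)
    show "finite (edges H)" using hypergraphD(2)[OF assms(1)] .
    have "f ` verts H = {..<n}"
    proof
      show "f ` verts H \<subseteq> {..<n}" using assms(2,3) fc by auto
      have "i = f (c i)" if "i < n" for i using fc that by simp
      then show "{..<n} \<subseteq> f ` verts H" unfolding assms(3) by blast
    qed
    then show "bij_betw f (verts H) (verts (cycle_hg n))" using inj by (simp add: bij_betw_def cycle_hg_def)
    show "inc (cycle_hg n) = id" by (simp add: cycle_hg_def)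
  next
    fix e assume "e \<in> edges H"
    then obtain i where "inc H e = {c i, c (Suc i)}" using assms(5) by blast
    then have "f ` inc H e = {i mod n, Suc (i mod n) mod n}" by (simp add: fc mod_Suc_eq)
    moreover have "i mod n < n" using assms(2) by simp
    ultimately show "f ` inc H e \<in> edges (cycle_hg n)" unfolding cycle_hg_def by auto
  next
    fix s assume "s \<in> edges (cycle_hg n)"
    then obtain j where j: "j < n" "s = {j, Suc j mod n}" by (auto simp: cycle_hg_def)
    then have s: "s = f ` {c j, c (Suc j)}" by (simp add: fc)
    have "{e \<in> edges H. f ` inc H e = s} = {e \<in> edges H. inc H e = {c j, c (Suc j)}}"
      using inj_on_image_eq_iff[OF inj sub, of _ "{c j, c (Suc j)}"] unfolding s assms(3) by auto
    then show "card {e \<in> edges H. f ` inc H e = s} = t" using assms(6) by simp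
  qed
qed

lemma verts_induced [simp]: "verts (induced H X) = X"
  by (simp add: induced_def)

lemma isomorphic_edgeless:
  "\<lbrakk>edges G = {}; edges H = {}; bij_betw f (verts G) (verts H)\<rbrakk> \<Longrightarrow> isomorphic G H"
  unfolding isomorphic_def by (intro exI[of _ f] exI[of _ undefined]) (auto simp: bij_betw_def)

lemma hypergraph_induced: "\<lbrakk>hypergraph H; X \<subseteq> verts H\<rbrakk> \<Longrightarrow> hypergraph (induced H X)"
  unfolding hypergraph_def induced_def by (auto intro: finite_subset)

lemma del_vert_induced: "del_vert (induced H X) v = induced H (X - {v})"
  unfolding del_vert_def induced_def by auto

section \<open>Members and critical hypergraphs of a property\<close>

locale property =
  fixes P :: "('v, 'e) hgraph set"
  assumes closed: "hypergraph_property P" and nontriv: "nontrivial P"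
    and hered: "hereditary P" and addit: "additive_prop P"
begin

lemma iso_closed: "\<lbrakk>G \<in> P; hypergraph H; isomorphic G H\<rbrakk> \<Longrightarrow> H \<in> P" for G H :: "('v, 'e) hgraph"
  using closed unfolding hypergraph_property_def by blast

lemma no_edge_induced:
  assumes "hypergraph H" "finite X" "card X \<le> 1"
  shows "edges (induced H X) = {}"
proof -
  have "\<not> inc H e \<subseteq> X" if "e \<in> edges H" for e
    using card_mono[OF assms(2), of "inc H e"] assms(3) hypergraphD(4)[OF assms(1) that] by linarith
  then show ?thesis by (auto simp: induced_def)
qed

lemma induced_empty:
  assumes "hypergraph H"
  shows "induced H {} \<in> P"
proof -
  obtain G where G: "G \<in> P" using nontriv unfolding nontrivial_def by blast
  then have hG: "hypergraph G" using closed unfolding hypergraph_property_def by blast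
  have "induced G {} \<in> P" using hered G unfolding hereditary_def by blast
  moreover have "isomorphic (induced G {}) (induced H {})"
    by (rule isomorphic_edgeless[of _ _ id]) (simp_all add: no_edge_induced hG assms)
  ultimately show ?thesis using iso_closed hypergraph_induced[OF assms] by blast
qed

lemma induced_singleton:
  assumes "hypergraph H" "v \<in> verts H"
  shows "induced H {v} \<in> P"
proof -
  obtain G w where G: "G \<in> P" "w \<in> verts G" using nontriv unfolding nontrivial_def by blast
  then have hG: "hypergraph G" using closed unfolding hypergraph_property_def by blast
  have "induced G {w} \<in> P" using hered G unfolding hereditary_def by blast
  moreover have "isomorphic (induced G {w}) (induced H {v})"
    by (rule isomorphic_edgeless[of _ _ "\<lambda>_. v"]) (simp_all add: no_edge_induced hG assms(1) bij_betw_def)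
  ultimately show ?thesis using iso_closed hypergraph_induced[OF assms(1)] assms(2) by blast
qed

text \<open>A set minimal with \<open>induced H K \<notin> P\<close> is critical. It is non-empty
  because \<open>P\<close> contains the empty hypergraph, and so \<open>degenerate\<close> yields a
  vertex in it.\<close>

lemma crit_induced:
  assumes "hypergraph H" "X \<subseteq> verts H" "induced H X \<notin> P"
  shows "\<exists>K\<subseteq>X. K \<noteq> {} \<and> induced H K \<in> crit P"
proof -
  have "finite X" using assms(1,2) hypergraphD(1) finite_subset by blast
  then show ?thesis using assms(2,3)
  proof (induction X rule: finite_psubset_induct)
    case (psubset X)
    show ?case
    proof (cases "\<forall>v\<in>X. induced H (X - {v}) \<in> P")
      case True
      have "X \<noteq> {}" using psubset.prems induced_empty[OF assms(1)] by auto
      moreover have "induced H X \<in> crit P"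
        using True psubset.prems hypergraph_induced[OF assms(1)]
        unfolding crit_def by (simp add: del_vert_induced)
      ultimately show ?thesis by blast
    next
      case False
      then obtain v where v: "v \<in> X" "induced H (X - {v}) \<notin> P" by blast
      then have "\<exists>K\<subseteq>X - {v}. K \<noteq> {} \<and> induced H K \<in> crit P"
        using psubset.IH[of "X - {v}"] psubset.prems by auto
      then show ?thesis by blast
    qed
  qed
qed

lemma crit_degree_le:
  assumes "G \<in> crit P" "v \<in> verts G"
  shows "crit_degree P \<le> degree G v"
proof -
  have "crit_degree P \<le> min_degree G" unfolding crit_degree_def using assms(1) by (rule cINF_lower[rotated]) simp
  also have "\<dots> \<le> degree G v" unfolding min_degree_def using assms(2) by (rule cINF_lower[rotated]) simp
  finally show ?thesis .
qed

lemma degenerate_in_property: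
  assumes "hypergraph H" "X \<subseteq> verts H" "degenerate H (crit_degree P) X"
  shows "induced H X \<in> P"
proof (rule ccontr)
  assume "induced H X \<notin> P"
  then obtain K where K: "K \<subseteq> X" "K \<noteq> {}" "induced H K \<in> crit P" using crit_induced[OF assms(1,2)] by blast
  then obtain v where v: "v \<in> K" "degree (induced H K) v < crit_degree P"
    using assms(3) unfolding degenerate_def by blast
  have "v \<in> verts (induced H K)" using v(1) by (simp add: induced_def)
  then show False using crit_degree_le[OF K(3)] v(2) by fastforce
qed

text \<open>
  A vertex \<open>v\<close> of degree 0 in a critical hypergraph would make it the disjoint union of two members of \<open>P\<close>.
\<close>

lemma crit_degree_pos: "0 < crit_degree P"
proof (rule ccontr)
  assume "\<not> ?thesis"
  then have zero: "crit_degree P = 0" by simp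
  obtain G0 :: "('v, 'e) hgraph" where G0: "hypergraph G0" "G0 \<notin> P" using nontriv unfolding nontrivial_def by blast
  have "induced G0 (verts G0) \<notin> P"
  proof
    assume m: "induced G0 (verts G0) \<in> P"
    have "isomorphic (induced G0 (verts G0)) G0"
      unfolding isomorphic_def using hypergraphD(3)[OF G0(1)]
      by (intro exI[of _ id] exI[of _ id]) (auto simp: induced_def bij_betw_def)
    then show False using iso_closed[OF m G0(1)] G0(2) by blast
  qed
  then have "crit P \<noteq> {}" using crit_induced[OF G0(1) order_refl] by blast
  then have "(INF G\<in>crit P. min_degree G) \<in> min_degree ` crit P" by (intro Inf_nat_def1) simp
  then obtain G where G: "G \<in> crit P" "min_degree G = 0" using zero unfolding crit_degree_def by auto
  have hG: "hypergraph G" "G \<notin> P" using G(1) unfolding crit_def by auto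
  \<comment> \<open>The empty hypergraph has minimum degree 0 by convention, so it must be ruled out
    before a vertex of degree 0 can be taken.\<close>
  have "verts G \<noteq> {}"
  proof
    assume e: "verts G = {}"
    have "edges G = {}"
    proof (rule equals0I)
      fix e assume e': "e \<in> edges G"
      show False using edge_other_vertex[OF hG(1) e'] hypergraphD(3)[OF hG(1) e'] e by blast
    qed
    then have "isomorphic (induced G {}) G"
      by (intro isomorphic_edgeless[of _ _ id]) (use e in \<open>auto simp: induced_def\<close>)
    then show False using iso_closed[OF induced_empty[OF hG(1)] hG(1)] hG(2) by blast
  qed
  then have "(INF v\<in>verts G. degree G v) \<in> degree G ` verts G" by (intro Inf_nat_def1) simp
  then obtain v where v: "v \<in> verts G" "degree G v = 0" using G(2) unfolding min_degree_def by auto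
  have noe: "v \<notin> inc G e" if "e \<in> edges G" for e
    using v(2) that hypergraphD(2)[OF hG(1)] unfolding degree_def by auto
  let ?U = "disj_union (del_vert G v) (induced G {v})"
  have "edges (induced G {v}) = {}" using no_edge_induced[OF hG(1), of "{v}"] by simp
  moreover have "del_vert G v \<in> P" using G(1) v(1) unfolding crit_def by simp
  moreover have "verts (del_vert G v) \<inter> verts (induced G {v}) = {}" by (simp add: del_vert_def induced_def)
  ultimately have "?U \<in> P"
    using addit induced_singleton[OF hG(1) v(1)] unfolding additive_prop_def by blast
  moreover have "isomorphic ?U G"
    unfolding isomorphic_def
  proof (intro exI[of _ id] conjI)
    have "verts ?U = verts G" using v(1) by (auto simp: disj_union_def del_vert_def)
    then show "bij_betw id (verts ?U) (verts G)" by simp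
    have "edges ?U = edges G"
      using noe hypergraphD(3)[OF hG(1)] by (auto simp: disj_union_def del_vert_def induced_def)
    then show "bij_betw id (edges ?U) (edges G)" by simp
    show "\<forall>e\<in>edges ?U. inc G (id e) = id ` inc ?U e"
      by (auto simp: disj_union_def del_vert_def induced_def)
  qed
  ultimately show False using iso_closed hG by blast
qed

lemma list_coloring_if_partial_coloring:
  assumes "hypergraph H" "partial_coloring H (crit_degree P) L (verts H) \<phi>"
  shows "list_coloring P H L \<phi>"
  unfolding list_coloring_def
proof (intro conjI ballI allI)
  show "\<phi> v \<in> L v" if "v \<in> verts H" for v using assms(2) that unfolding partial_coloring_def by blast
  show "induced H {v \<in> verts H. \<phi> v = c} \<in> P" for c
    by (rule degenerate_in_property[OF assms(1)]) (use assms(2) in \<open>auto simp: partial_coloring_def\<close>)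
qed

text \<open>This settles \<open>k = 1\<close>. By connectedness every non-empty proper vertex set
  has a vertex that loses an edge, so proper subsets are degenerate and induce members of
  \<open>P\<close>. In a failing colouring the bad class must then be the whole vertex set.\<close>

lemma regular_crit:
  assumes "hypergraph H" "connected_hg H" "regular (crit_degree P) H"
    and "\<And>v. v \<in> verts H \<Longrightarrow> L v \<noteq> {}" "\<nexists>\<phi>. list_coloring P H L \<phi>"
  shows "H \<in> crit P"
proof -
  have proper: "induced H X \<in> P" if X: "X \<subseteq> verts H" "X \<noteq> verts H" for X
  proof (rule degenerate_in_property[OF assms(1) X(1)])
    show "degenerate H (crit_degree P) X"
      unfolding degenerate_def
    proof (intro allI impI)
      fix K assume K: "K \<subseteq> X" "K \<noteq> {}"
      then have K': "K \<subseteq> verts H" "K \<noteq> verts H" using X by auto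
      obtain e where e: "e \<in> edges H" "inc H e \<inter> K \<noteq> {}" "\<not> inc H e \<subseteq> K"
        by (rule connected_crossing_edge[OF assms(2) K'(1) K(2) K'(2)]) blast
      then obtain v where v: "v \<in> inc H e" "v \<in> K" by blast
      have "{e \<in> edges H. inc H e \<subseteq> K \<and> v \<in> inc H e} \<subset> {e \<in> edges H. v \<in> inc H e}" using e v by blast
      then have "degree (induced H K) v < degree H v"
        unfolding degree_induced degree_def[of H]
        by (rule psubset_card_mono[rotated]) (use hypergraphD(2)[OF assms(1)] in simp)
      then have "degree (induced H K) v < crit_degree P"
        using assms(3) v(2) K'(1) unfolding regular_def by auto
      then show "\<exists>v\<in>K. degree (induced H K) v < crit_degree P" using v(2) by blast
    qed
  qed
  have "\<forall>v\<in>verts H. \<exists>c. c \<in> L v" using assms(4) by blast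
  from bchoice[OF this] obtain \<phi> where "\<forall>v\<in>verts H. \<phi> v \<in> L v" by blast
  moreover have "\<not> list_coloring P H L \<phi>" using assms(5) by blast
  ultimately obtain c where c: "induced H {v \<in> verts H. \<phi> v = c} \<notin> P"
    unfolding list_coloring_def by blast
  have "{v \<in> verts H. \<phi> v = c} = verts H"
  proof (rule ccontr)
    assume "\<not> ?thesis"
    then have "induced H {v \<in> verts H. \<phi> v = c} \<in> P" by (intro proper) auto
    then show False using c by contradiction
  qed
  then have "induced H (verts H) \<notin> P" using c by simp
  then have "H \<notin> P" using hered unfolding hereditary_def by blast
  moreover have "del_vert H v \<in> P" if "v \<in> verts H" for v
    unfolding del_vert_def by (rule proper) (use that in auto)
  ultimately show ?thesis using assms(1) unfolding crit_def by blast
qed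

end

section \<open>The bound and the extremal cases\<close>

lemma list_coloring_mono:
  assumes "list_coloring P H L' \<phi>" "\<And>v. v \<in> verts H \<Longrightarrow> L' v \<subseteq> L v"
  shows "list_coloring P H L \<phi>"
  using assms unfolding list_coloring_def by blast

lemma finite_sublists:
  assumes "\<forall>v\<in>X. finite (L v) \<longrightarrow> k \<le> card (L v)"
  obtains L' where "\<And>v. v \<in> X \<Longrightarrow> L' v \<subseteq> L v \<and> finite (L' v) \<and> card (L' v) = k"
proof -
  have "\<exists>S. S \<subseteq> L v \<and> finite S \<and> card S = k" if "v \<in> X" for v
  proof (cases "finite (L v)")
    case True
    then have "k \<le> card (L v)" using assms that by blast
    then show ?thesis by (metis obtain_subset_with_card_n)
  next
    case False
    then show ?thesis using infinite_arbitrarily_large by metis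
  qed
  then have "\<forall>v\<in>X. \<exists>S. S \<subseteq> L v \<and> finite S \<and> card S = k" by blast
  from bchoice[OF this] show ?thesis using that by blast
qed

lemma degree_le_max_degree: "\<lbrakk>hypergraph H; v \<in> verts H\<rbrakk> \<Longrightarrow> degree H v \<le> max_degree H"
  unfolding max_degree_def by (rule cSUP_upper) (auto simp: hypergraph_def)

theorem theorem1p5:
  fixes P :: "('v::infinite, 'e::infinite) hgraph set"
    and H :: "('v, 'e) hgraph"
    and r :: nat
  assumes "hypergraph_property P"
    and "nontrivial P"
    and "hereditary P"
    and "additive_prop P"
    and "crit_degree P = r"
    and "hypergraph H"
    and "connected_hg H"
  shows "int (list_chromatic_number H P) \<le> \<lceil>real (max_degree H) / real r\<rceil> + 1 \<and>
    (int (list_chromatic_number H P) = \<lceil>real (max_degree H) / real r\<rceil> + 1 \<longrightarrow>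
      (\<exists>t k. t \<ge> 1 \<and> t dvd k * r + t \<and>
             isomorphic H (multiple t (complete_hg ((k * r + t) div t)))) \<or>
      (\<exists>n. n \<ge> 3 \<and> odd n \<and> isomorphic H (multiple r (cycle_hg n)) \<and>
           list_chromatic_number H P = 3) \<or>
      (regular r H \<and> H \<in> crit P))"
proof -
  interpret property P by unfold_locales (use assms in auto)
  have r: "0 < r" using crit_degree_pos assms(5) by simp
  define k where "k = nat \<lceil>real (max_degree H) / real r\<rceil>"
  let ?\<chi> = "list_chromatic_number H P"
  define Q where "Q m \<longleftrightarrow> (\<forall>L :: 'v \<Rightarrow> nat set. (\<forall>v\<in>verts H. finite (L v) \<longrightarrow> m \<le> card (L v)) \<longrightarrow>
      (\<exists>\<phi>. list_coloring P H L \<phi>))" for m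
  have \<chi>: "?\<chi> = (LEAST m. Q m)" unfolding list_chromatic_number_def Q_def ..
  have k: "int k = \<lceil>real (max_degree H) / real r\<rceil>"
    unfolding k_def by (simp add: order_less_le_trans[of "-1" 0])
  have "real (max_degree H) / real r \<le> real k" using k by (metis le_of_int_ceiling of_int_of_nat_eq)
  then have "real (max_degree H) \<le> real k * real r" using r by (simp add: pos_divide_le_eq)
  then have "max_degree H \<le> k * r" by (metis of_nat_le_iff of_nat_mult)
  then have deg: "degree H v \<le> r * k" if "v \<in> verts H" for v
    using degree_le_max_degree[OF assms(6) that] by (simp add: mult.commute)
  \<comment> \<open>With \<open>k + 1\<close> colours per list, \<open>r * (k + 1)\<close> exceeds
    every degree and the greedy colouring succeeds.\<close>
  have "Q (Suc k)" unfolding Q_def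
  proof (intro allI impI)
    fix L :: "'v \<Rightarrow> nat set" assume "\<forall>v\<in>verts H. finite (L v) \<longrightarrow> Suc k \<le> card (L v)"
    then obtain L' where L': "\<And>v. v \<in> verts H \<Longrightarrow> L' v \<subseteq> L v \<and> finite (L' v) \<and> card (L' v) = Suc k"
      by (rule finite_sublists) blast
    have "\<exists>\<phi>. partial_coloring H r L' (verts H) \<phi>"
    proof (rule greedy_coloring[OF assms(6)])
      show "finite (L' v) \<and> degree H v < r * card (L' v)" if "v \<in> verts H" for v
        using L'[OF that] deg[OF that] r by simp
    qed
    then obtain \<phi> where "list_coloring P H L' \<phi>"
      using list_coloring_if_partial_coloring[OF assms(6)] assms(5) by blast
    then have "list_coloring P H L \<phi>" by (rule list_coloring_mono) (use L' in blast)
    then show "\<exists>\<phi>. list_coloring P H L \<phi>" by blast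
  qed
  then have "?\<chi> \<le> Suc k" unfolding \<chi> by (rule Least_le)
  then have upper: "int ?\<chi> \<le> \<lceil>real (max_degree H) / real r\<rceil> + 1" using k by linarith
  have extremal: "(\<exists>t k. t \<ge> 1 \<and> t dvd k * r + t \<and>
             isomorphic H (multiple t (complete_hg ((k * r + t) div t)))) \<or>
      (\<exists>n. n \<ge> 3 \<and> odd n \<and> isomorphic H (multiple r (cycle_hg n)) \<and> ?\<chi> = 3) \<or>
      (regular r H \<and> H \<in> crit P)" (is "?complete \<or> ?cycle \<or> ?crit")
    if eq: "int ?\<chi> = \<lceil>real (max_degree H) / real r\<rceil> + 1"
  proof -
    have \<chi>k: "?\<chi> = Suc k" using eq k by linarith
    then have "\<not> Q k" unfolding \<chi> by (intro not_less_Least) simp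
    then obtain L :: "'v \<Rightarrow> nat set" where L: "\<forall>v\<in>verts H. finite (L v) \<longrightarrow> k \<le> card (L v)"
      "\<nexists>\<phi>. list_coloring P H L \<phi>" unfolding Q_def by blast
    obtain L' where L': "\<And>v. v \<in> verts H \<Longrightarrow> L' v \<subseteq> L v \<and> finite (L' v) \<and> card (L' v) = k"
      by (rule finite_sublists[OF L(1)]) blast
    have nc: "\<nexists>\<phi>. list_coloring P H L' \<phi>" using list_coloring_mono[of P H L' _ L] L' L(2) by blast
    then have un: "\<not> partial_coloring H r L' (verts H) \<phi>" for \<phi>
      using list_coloring_if_partial_coloring[OF assms(6)] assms(5) by blast
    show ?thesis
    proof (cases "k = 0")
      case True
      \<comment> \<open>All degrees are 0 here, so connectedness leaves one vertex: \<open>H\<close>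
        is \<open>K_1\<close>, the complete case with \<open>t = 1\<close> and \<open>k = 0\<close>.
        The empty hypergraph is excluded because it is coloured trivially.\<close>
      have "verts H \<noteq> {}" using un partial_coloring_empty[of H r L'] by auto
      then obtain v where v: "v \<in> verts H" by blast
      have noe: "v \<notin> inc H e" if "e \<in> edges H" for e
        using deg[OF v] True that hypergraphD(2)[OF assms(6)] unfolding degree_def by auto
      have V: "verts H = {v}"
      proof (rule ccontr)
        assume ne: "verts H \<noteq> {v}"
        have "{v} \<subseteq> verts H" "{v} \<noteq> {}" "{v} \<noteq> verts H" using v ne by auto
        then obtain e where "e \<in> edges H" "inc H e \<inter> {v} \<noteq> {}" "\<not> inc H e \<subseteq> {v}"
          by (rule connected_crossing_edge[OF assms(7)])
        then show False using noe by blast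
      qed
      have "edges H = {}"
      proof (rule equals0I)
        fix e assume e: "e \<in> edges H"
        show False
          using edge_other_vertex[OF assms(6) e, of v] hypergraphD(3)[OF assms(6) e] V by blast
      qed
      then have "isomorphic H (multiple 1 (complete_hg (card (verts H))))"
        by (intro isomorphic_complete[OF assms(6)]) (use V in auto)
      then have "isomorphic H (multiple 1 (complete_hg ((0 * r + 1) div 1)))" using V by simp
      then have ?complete by (intro exI[of _ 1] exI[of _ 0]) simp
      then show ?thesis by blast
    next
      case False
      interpret tight_lists H L' r k
        by unfold_locales (use assms r False L' deg un in auto)
      show ?thesis
      proof (cases "k = 1")
        case True
        then have reg: "regular r H" using regular unfolding regular_def by simp
        have "H \<in> crit P"
        proof (rule regular_crit[OF assms(6,7) _ _ nc])
          show "regular (crit_degree P) H" using reg assms(5) by simp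
          show "L' v \<noteq> {}" if "v \<in> verts H" for v using L'[OF that] False by auto
        qed
        then show ?thesis using reg by blast
      next
        case k1: False
        then have "2 \<le> k" using False by simp
        then show ?thesis
        proof (rule complete_or_odd_cycle)
          fix t
          assume t: "1 \<le> t" "t * (card (verts H) - 1) = r * k" "\<And>e. e \<in> edges H \<Longrightarrow> card (inc H e) = 2"
            "\<And>u v. \<lbrakk>u \<in> verts H; v \<in> verts H; u \<noteq> v\<rbrakk> \<Longrightarrow> card {e \<in> edges H. inc H e = {u, v}} = t"
          have "0 < card (verts H)" using verts_nonempty hypergraphD(1)[OF assms(6)] by (simp add: card_gt_0_iff)
          \<comment> \<open>Adding \<open>t\<close> to
            \<open>t * (card (verts H) - 1) = r * k\<close> gives both the divisibility and the
            order \<open>(k * r + t) div t\<close> of the complete graph.\<close>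
          then have n: "k * r + t = t * card (verts H)"
            using t(2) by (cases "card (verts H)") (auto simp: algebra_simps)
          have "isomorphic H (multiple t (complete_hg (card (verts H))))"
            by (rule isomorphic_complete[OF assms(6) t(3,4)])
          then have ?complete using n t(1) by (intro exI[of _ t] exI[of _ k]) simp
          then show ?thesis by blast
        next
          fix c n
          assume c: "k = 2" "3 \<le> n" "odd n" "verts H = range c" "\<And>i j. c i = c j \<longleftrightarrow> i mod n = j mod n"
            "\<And>e. e \<in> edges H \<Longrightarrow> \<exists>i. inc H e = {c i, c (Suc i)}"
            "\<And>i. card {e \<in> edges H. inc H e = {c i, c (Suc i)}} = r"
          have "isomorphic H (multiple r (cycle_hg n))"
            by (rule isomorphic_cycle[OF assms(6) _ c(4-7)]) (use c(2) in simp)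
          then show ?thesis using c(1-3) \<chi>k by auto
        qed
      qed
    qed
  qed
  show ?thesis using upper extremal by blast
qed

end
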